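(* For every $i$ the induced map $$H^i(\Upsilon_{\mathrm{basic}}):\ \mathcal{B}^i\cong H^i(\mathcal{B}_{\mathrm{basic}})\longrightarrow H^i(\mathcal{W}_{\mathrm{basic}}),\qquad x\mapsto[\Upsilon^i(x)],$$ is an isomorphism.
   Context: All vector spaces are over $\mathbb{Q}$. **Symmetric Jacobi diagrams and $\mathcal{B}$.** A symmetric Jacobi diagram is a finite graph (possibly empty or disconnected; parallel edges and self-loop edges allowed) whose vertices all have degree 1 (legs) or degree 3, where each trivalent vertex with three distinct incident edges carries a cyclic ordering of these edges (an orientation). Isomorphisms respect orientations. AS relations: $D+D'=0$ if $D'$ is obtained from $D$ by reversing the orientation of one trivalent vertex; and $D=0$ if $D$ has a self-loop edge. IHX relations: $T(a,b|c,e)+T(b,c|a,e)+T(c,a|b,e)=0$, where $T(a,b|c,e)$ denotes a diagram with an edge $f$ joining two trivalent vertices with cyclic orders $(a,b,f)$ and $(f,c,e)$, $a,b,c,e$ being the four other (half-)edges, the three diagrams being identical elsewhere. $\mathcal{B}$ is the space of finite formal linear combinations of isomorphism classes of symmetric Jacobi diagrams modulo AS and IHX. $\mathcal{B}^i\subset\mathcal{B}$ is spanned by diagrams with leg-grade $i$, where leg-grade is twice the number of legs (so $\mathcal{B}^i=0$ for odd $i$). The spaces $\mathcal{B}^i$ are regarded as a cochain complex with zero differential, and as an $\iota$-complex with $\mathcal{B}_\iota=0$ and $\iota=0$, so $H^i(\mathcal{B}_{\mathrm{basic}})=\mathcal{B}^i$. **Weil diagrams.** A Weil diagram is a finite graph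 (possibly empty or disconnected; parallel edges and self-loop edges allowed) whose vertices all have degree 1 (legs) or degree 3, where each trivalent vertex with three distinct incident edges carries a cyclic ordering of these edges (an orientation), with its set of legs totally ordered and each leg assigned a grade 1 or 2; its leg-grade is the sum of the grades of its legs. A Weil diagram with a special vertex is the same except that exactly one degree-1 vertex (the special vertex, labelled $\iota$) is neither ordered nor graded (and is not counted as a leg). Perm relations: if $D'$ is obtained from $D$ by exchanging the positions of two adjacent legs of grades $x,y$, then $D=(-1)^{xy}D'$. $\mathcal{W}^i$ (resp. $\mathcal{W}^i_\iota$) is the space of finite linear combinations of isomorphism classes of Weil diagrams (resp. Weil diagrams with a special vertex) of leg-grade $i$, modulo AS, IHX and Perm. **Operators.** An operator of grade $j$ given by leg substitution rules sends a diagram with ordered legs $\ell_1<\dots<\ell_n$ of grades $g_1,\dots,g_n$ to $\sum_k(-1)^{j(g_1+\dots+g_{k-1})}D_k$, where $D_k$ results from replacing $\ell_k$, in place, according to the rule. The differential $d:\mathcal{W}^i\to\mathcal{W}^{i+1}$ has grade $+1$: a grade 1 leg is replaced by a grade 2 leg; a grade 2 leg is replaced by $0$. The map $\iota:\mathcal{W}^i\to\mathcal{W}^{i-1}_\iota$ has grade $-1$: a grade 1 leg is turned into the special vertex; a grade 2 leg is replaced by a trivalent vertex with cyclic order (stem, edge to the special vertex, edge to a new grade 1 leg), the new leg occupying the old position, where the stem is the edge formerly ending at the leg. $\mathcal{W}_{\mathrm{basic}}$ is the subcomplex $\mathcal{W}^i_{\mathrm{basic}}=\ker(\iota:\mathcal{W}^i\to\mathcal{W}_\iota^{i-1})$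 with differential $d$. **The map $\Upsilon$.** $\Upsilon^i:\mathcal{B}^i\to\mathcal{W}^i$: choose an ordering of the legs of a symmetric Jacobi diagram, and replace each leg by (a grade 2 leg) $-\frac12$(a fork), where a fork means a trivalent vertex with cyclic order (stem, left leg, right leg) whose left and right legs are two grade 1 legs placed consecutively (left then right) at the position of the original leg; expand multilinearly. It takes values in $\mathcal{W}_{\mathrm{basic}}$-cocycles. *)

theory Defs
  imports Complex_Main "HOL-Library.Multiset" "HOL-Library.Poly_Mapping"
begin

section \<open>Rational vector spaces freely generated by a type\<close>

type_synonym 'a free = "'a \<Rightarrow>\<^sub>0 rat"

definition smult :: "rat \<Rightarrow> 'a free \<Rightarrow> 'a free" where
  "smult c p = Poly_Mapping.map ((*) c) p"

abbreviation gen :: "'a \<Rightarrow> 'a free" where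
  "gen x \<equiv> Poly_Mapping.single x 1"

lemma lookup_smult [simp]: "Poly_Mapping.lookup (smult c p) x = c * Poly_Mapping.lookup p x"
  unfolding smult_def by transfer (auto simp: when_def)

global_interpretation free: vector_space smult
  defines free_span = free.span
  by unfold_locales (auto intro!: poly_mapping_eqI simp: lookup_add algebra_simps)

text \<open>The linear extension of a map on generators.\<close>

definition lin_ext :: "('a \<Rightarrow> 'b free) \<Rightarrow> 'a free \<Rightarrow> 'b free" where
  "lin_ext f p = (\<Sum>x\<in>Poly_Mapping.keys p. smult (Poly_Mapping.lookup p x) (f x))"

lemma lin_ext_superset:
  assumes "finite A" "Poly_Mapping.keys p \<subseteq> A"
  shows "lin_ext f p = (\<Sum>x\<in>A. smult (Poly_Mapping.lookup p x) (f x))"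
  unfolding lin_ext_def
  by (rule sum.mono_neutral_left) (use assms in \<open>auto simp: in_keys_iff\<close>)

lemma lin_ext_add: "lin_ext f (p + q) = lin_ext f p + lin_ext f q"
proof -
  let ?A = "Poly_Mapping.keys p \<union> Poly_Mapping.keys q"
  have "lin_ext f (p + q) = (\<Sum>x\<in>?A. smult (Poly_Mapping.lookup (p + q) x) (f x))"
    by (rule lin_ext_superset) (auto simp: in_keys_iff lookup_add)
  also have "\<dots> = (\<Sum>x\<in>?A. smult (Poly_Mapping.lookup p x) (f x))
      + (\<Sum>x\<in>?A. smult (Poly_Mapping.lookup q x) (f x))"
    by (simp add: lookup_add free.scale_left_distrib sum.distrib)
  also have "\<dots> = lin_ext f p + lin_ext f q"
    by (simp add: lin_ext_superset[of ?A])
  finally show ?thesis .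
qed

lemma lin_ext_smult: "lin_ext f (smult c p) = smult c (lin_ext f p)"
proof -
  have "lin_ext f (smult c p)
      = (\<Sum>x\<in>Poly_Mapping.keys p. smult (Poly_Mapping.lookup (smult c p) x) (f x))"
    by (rule lin_ext_superset) (auto simp: in_keys_iff)
  then show ?thesis
    by (simp add: lin_ext_def free.scale_sum_right)
qed

lemma linear_lin_ext: "Vector_Spaces.linear smult smult (lin_ext f)"
  by unfold_locales (simp_all add: lin_ext_add lin_ext_smult)

interpretation lin_ext: Vector_Spaces.linear smult smult "lin_ext f" for f
  by (rule linear_lin_ext)

lemma lin_ext_single [simp]: "lin_ext f (Poly_Mapping.single x c) = smult c (f x)"
  by (cases "c = 0") (simp_all add: lin_ext_def)

lemma lin_ext_sum_list: "lin_ext f (sum_list ps) = sum_list (map (lin_ext f) ps)"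
  by (induction ps) (simp_all add: lin_ext_add lin_ext.zero)

lemma lin_ext_span:
  assumes "\<And>r. r \<in> R \<Longrightarrow> lin_ext f r \<in> free_span R'" and "x \<in> free_span R"
  shows "lin_ext f x \<in> free_span R'"
  using assms(2)
proof (induction rule: free.span_induct_alt)
  case base
  then show ?case by (simp add: lin_ext.zero free.span_zero)
next
  case (step c x y)
  then show ?case
    by (simp add: lin_ext_add lin_ext_smult assms(1) free.span_add free.span_scale)
qed


section \<open>Oriented uni-trivalent graphs\<close>

text \<open>
  A graph is encoded by its half-edges: \<open>opp\<close> is the fixed-point free involution whose orbits
  are the edges, and the orbits of \<open>rot\<close> are the vertices, \<open>rot\<close> giving the cyclic ordering at
  each vertex. All orbits of \<open>rot\<close> have size 1 or 3 iff the third power of \<open>rot\<close> is the identity.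
  At a trivalent vertex with a self-loop the two cyclic orderings of its half-edges differ by
  the automorphism of the graph that exchanges the two halves of the loop, so that up to
  isomorphism such a vertex carries no orientation. The values of \<open>rot\<close> and \<open>opp\<close> outside
  \<open>half_edges\<close> are irrelevant up to isomorphism.

  The type of half-edges is just an infinite set, with injections that provide the new
  half-edges needed when vertices are inserted.
\<close>

datatype half_edge =
    Atom nat
  | Old half_edge
  | ForkL half_edge | ForkR half_edge
  | EndL half_edge | EndR half_edge

record ugraph =
  half_edges :: "half_edge set"
  rot :: "half_edge \<Rightarrow> half_edge"
  opp :: "half_edge \<Rightarrow> half_edge"

definition unitrivalent :: "ugraph \<Rightarrow> bool" where
  "unitrivalent G \<longleftrightarrow> finite (half_edges G) \<and>
    (\<forall>h\<in>half_edges G.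
      rot G h \<in> half_edges G \<and> rot G (rot G (rot G h)) = h \<and>
      opp G h \<in> half_edges G \<and> opp G (opp G h) = h \<and> opp G h \<noteq> h)"

text \<open>A vertex of degree 1 is identified with the half-edge at it.\<close>

definition univalent :: "ugraph \<Rightarrow> half_edge set" where
  "univalent G = {h \<in> half_edges G. rot G h = h}"

definition graph_iso :: "(half_edge \<Rightarrow> half_edge) \<Rightarrow> ugraph \<Rightarrow> ugraph \<Rightarrow> bool" where
  "graph_iso f G G' \<longleftrightarrow> bij_betw f (half_edges G) (half_edges G') \<and>
    (\<forall>h\<in>half_edges G. f (rot G h) = rot G' (f h) \<and> f (opp G h) = opp G' (f h))"

text \<open>Reversal of the orientation of the vertex at the half-edge \<open>h\<close>.\<close>

definition reverse_at :: "half_edge \<Rightarrow> ugraph \<Rightarrow> ugraph" where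
  "reverse_at h G = G\<lparr>rot := (\<lambda>x. if x \<in> {h, rot G h, rot G (rot G h)}
     then rot G (rot G x) else rot G x)\<rparr>"

text \<open>The diagram \<open>T(a,b|c,e)\<close>, where the edge \<open>f\<close> has the half-edge \<open>u\<close> at the vertex with
  cyclic order \<open>(a,b,f)\<close> and the half-edge \<open>v\<close> at the vertex with cyclic order \<open>(f,c,e)\<close>.\<close>

definition tree_T ::
  "ugraph \<Rightarrow> half_edge \<Rightarrow> half_edge \<Rightarrow> half_edge \<Rightarrow> half_edge \<Rightarrow> half_edge \<Rightarrow> half_edge \<Rightarrow> ugraph" where
  "tree_T G u v a b c e =
     G\<lparr>rot := (rot G)(a := b, b := u, u := a, v := c, c := e, e := v)\<rparr>"

text \<open>The lists of graphs whose sum is set to zero by the AS and IHX relations.\<close>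

inductive local_relation :: "ugraph list \<Rightarrow> bool" where
  AS: "\<lbrakk>h \<in> half_edges G; rot G h \<noteq> h\<rbrakk> \<Longrightarrow> local_relation [G, reverse_at h G]"
| self_loop: "\<lbrakk>h \<in> half_edges G; rot G h \<noteq> h; opp G h = rot G h\<rbrakk> \<Longrightarrow> local_relation [G]"
| IHX: "\<lbrakk>{u, v, a, b, c, e} \<subseteq> half_edges G; distinct [u, v, a, b, c, e]; opp G u = v;
      rot G a = b; rot G b = u; rot G u = a; rot G v = c; rot G c = e; rot G e = v\<rbrakk>
    \<Longrightarrow> local_relation [tree_T G u v a b c e, tree_T G u v b c a e, tree_T G u v c a b e]"

text \<open>Each degree-1 vertex \<open>h\<close> in \<open>S\<close> is replaced by a trivalent vertex with cyclic order
  (stem, left edge, right edge), the left and right edges ending in the new degree-1 vertices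
  \<open>EndL h\<close> and \<open>EndR h\<close>.\<close>

fun sprout_rot :: "half_edge set \<Rightarrow> ugraph \<Rightarrow> half_edge \<Rightarrow> half_edge" where
  "sprout_rot S G (Old h) = (if h \<in> S then ForkL h else Old (rot G h))"
| "sprout_rot S G (ForkL h) = ForkR h"
| "sprout_rot S G (ForkR h) = Old h"
| "sprout_rot S G h = h"

fun sprout_opp :: "ugraph \<Rightarrow> half_edge \<Rightarrow> half_edge" where
  "sprout_opp G (Old h) = Old (opp G h)"
| "sprout_opp G (ForkL h) = EndL h"
| "sprout_opp G (EndL h) = ForkL h"
| "sprout_opp G (ForkR h) = EndR h"
| "sprout_opp G (EndR h) = ForkR h"
| "sprout_opp G h = h"

definition sprout :: "half_edge set \<Rightarrow> ugraph \<Rightarrow> ugraph" where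
  "sprout S G = \<lparr>
     half_edges = Old ` half_edges G \<union> ForkL ` S \<union> ForkR ` S \<union> EndL ` S \<union> EndR ` S,
     rot = sprout_rot S G,
     opp = sprout_opp G\<rparr>"


section \<open>Symmetric Jacobi diagrams\<close>

text \<open>The formal linear combinations of isomorphism classes are obtained by also
  identifying isomorphic diagrams.\<close>

definition jacobi_relations :: "ugraph free set" where
  "jacobi_relations =
     {gen G - gen G' | G G' f. unitrivalent G \<and> unitrivalent G' \<and> graph_iso f G G'} \<union>
     {(\<Sum>G\<leftarrow>Gs. gen G) | Gs. local_relation Gs \<and> (\<forall>G\<in>set Gs. unitrivalent G)}"

definition jacobi_equiv :: "ugraph free \<Rightarrow> ugraph free \<Rightarrow> bool" where
  "jacobi_equiv x y \<longleftrightarrow> x - y \<in> free_span jacobi_relations"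

lemma equivp_span:
  "equivp (\<lambda>x y :: 'a free. x - y \<in> free_span R)"
proof (rule equivpI)
  show "reflp (\<lambda>x y. x - y \<in> free_span R)"
    by (rule reflpI) (simp add: free.span_zero)
  show "symp (\<lambda>x y. x - y \<in> free_span R)"
    by (metis (no_types, lifting) free.span_neg minus_diff_eq sympI)
  show "transp (\<lambda>x y. x - y \<in> free_span R)"
    by (rule transpI) (metis (no_types, lifting) diff_add_cancel add_diff_eq free.span_add)
qed

text \<open>The generators \<open>G\<close> that are not uni-trivalent occur in no relation, and are discarded by
  passing to the span \<open>B_grade i\<close> of the classes of the uni-trivalent ones. The relations are
  homogeneous, so \<open>B_grade i\<close> is the quotient of the combinations of diagrams of leg-grade \<open>i\<close>.\<close>

quotient_type jacobi_space = "ugraph free" / jacobi_equiv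
  unfolding jacobi_equiv_def by (rule equivp_span)

instantiation jacobi_space :: ab_group_add
begin

lift_definition zero_jacobi_space :: jacobi_space is 0 .
lift_definition plus_jacobi_space :: "jacobi_space \<Rightarrow> jacobi_space \<Rightarrow> jacobi_space" is "(+)"
  unfolding jacobi_equiv_def by (metis add_diff_add free.span_add)
lift_definition uminus_jacobi_space :: "jacobi_space \<Rightarrow> jacobi_space" is uminus
  unfolding jacobi_equiv_def by (metis free.span_neg minus_diff_minus)
lift_definition minus_jacobi_space :: "jacobi_space \<Rightarrow> jacobi_space \<Rightarrow> jacobi_space" is "(-)"
  unfolding jacobi_equiv_def by (metis diff_diff_add diff_add_eq
      free.span_diff add_diff_eq diff_add_eq_diff_diff_swap)

instance
  by standard (transfer; simp add: jacobi_equiv_def free.span_zero algebra_simps)+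

end

lift_definition scaleJ :: "rat \<Rightarrow> jacobi_space \<Rightarrow> jacobi_space" is smult
  unfolding jacobi_equiv_def by (metis free.scale_right_diff_distrib free.span_scale)

global_interpretation jacobi: vector_space scaleJ
  defines jacobi_span = jacobi.span
  by unfold_locales (transfer; simp add: jacobi_equiv_def free.span_zero
      free.scale_right_distrib free.scale_left_distrib)+

lift_definition jacobi_class :: "ugraph \<Rightarrow> jacobi_space" is gen .

definition B_grade :: "int \<Rightarrow> jacobi_space set" where
  "B_grade i = jacobi_span {jacobi_class G | G. unitrivalent G \<and> 2 * int (card (univalent G)) = i}"


section \<open>Weil diagrams\<close>

text \<open>The legs are listed in order, each together with its grade.\<close>

datatype weil = Weil (graph: ugraph) (legs: "(half_edge \<times> nat) list") (special: "half_edge option")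

definition weil_diagram :: "weil \<Rightarrow> bool" where
  "weil_diagram D \<longleftrightarrow> unitrivalent (graph D) \<and>
     distinct (map fst (legs D)) \<and>
     fst ` set (legs D) \<inter> set_option (special D) = {} \<and>
     fst ` set (legs D) \<union> set_option (special D) = univalent (graph D) \<and>
     snd ` set (legs D) \<subseteq> {1, 2}"

definition leg_grade :: "weil \<Rightarrow> int" where
  "leg_grade D = int (sum_list (map snd (legs D)))"

definition weil_iso :: "(half_edge \<Rightarrow> half_edge) \<Rightarrow> weil \<Rightarrow> weil \<Rightarrow> bool" where
  "weil_iso f D D' \<longleftrightarrow> graph_iso f (graph D) (graph D') \<and>
     legs D' = map (apfst f) (legs D) \<and> special D' = map_option f (special D)"

definition weil_relations :: "weil free set" where
  "weil_relations =
     {gen D - gen D' | D D' f. weil_diagram D \<and> weil_diagram D' \<and> weil_iso f D D'} \<union>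
     {(\<Sum>G\<leftarrow>Gs. gen (Weil G ls s)) | Gs ls s.
        local_relation Gs \<and> (\<forall>G\<in>set Gs. weil_diagram (Weil G ls s))} \<union>
     {gen (Weil G (xs @ [(k, x), (l, y)] @ ys) s)
        - smult ((-1) ^ (x * y)) (gen (Weil G (xs @ [(l, y), (k, x)] @ ys) s)) | G xs k x l y ys s.
        weil_diagram (Weil G (xs @ [(k, x), (l, y)] @ ys) s)}"

definition weil_equiv :: "weil free \<Rightarrow> weil free \<Rightarrow> bool" where
  "weil_equiv x y \<longleftrightarrow> x - y \<in> free_span weil_relations"

text \<open>As above, generators that are not Weil diagrams occur in no relation and are discarded by
  passing to spans. The relations preserve the leg-grade and the presence of a special vertex, so the quotients
  \<open>W_grade i\<close> and \<open>W_iota_grade i\<close> below embed as subspaces of one common quotient.\<close>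

quotient_type weil_space = "weil free" / weil_equiv
  unfolding weil_equiv_def by (rule equivp_span)

instantiation weil_space :: ab_group_add
begin

lift_definition zero_weil_space :: weil_space is 0 .
lift_definition plus_weil_space :: "weil_space \<Rightarrow> weil_space \<Rightarrow> weil_space" is "(+)"
  unfolding weil_equiv_def by (metis add_diff_add free.span_add)
lift_definition uminus_weil_space :: "weil_space \<Rightarrow> weil_space" is uminus
  unfolding weil_equiv_def by (metis free.span_neg minus_diff_minus)
lift_definition minus_weil_space :: "weil_space \<Rightarrow> weil_space \<Rightarrow> weil_space" is "(-)"
  unfolding weil_equiv_def by (metis diff_diff_add diff_add_eq
      free.span_diff add_diff_eq diff_add_eq_diff_diff_swap)

instance
  by standard (transfer; simp add: weil_equiv_def free.span_zero algebra_simps)+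

end

lift_definition scaleW :: "rat \<Rightarrow> weil_space \<Rightarrow> weil_space" is smult
  unfolding weil_equiv_def by (metis free.scale_right_diff_distrib free.span_scale)

global_interpretation weil: vector_space scaleW
  defines weil_span = weil.span
  by unfold_locales (transfer; simp add: weil_equiv_def free.span_zero
      free.scale_right_distrib free.scale_left_distrib)+

lift_definition weil_class :: "weil \<Rightarrow> weil_space" is gen .

definition W_grade :: "int \<Rightarrow> weil_space set" where
  "W_grade i = weil_span {weil_class D | D. weil_diagram D \<and> special D = None \<and> leg_grade D = i}"

definition W_iota_grade :: "int \<Rightarrow> weil_space set" where
  "W_iota_grade i = weil_span {weil_class D | D. weil_diagram D \<and> special D \<noteq> None \<and> leg_grade D = i}"


lemma abs_weil_space_eq: "abs_weil_space p = abs_weil_space q \<longleftrightarrow> p - q \<in> free_span weil_relations"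
  by (simp add: weil_space.abs_eq_iff weil_equiv_def)

lemma abs_weil_space_eq_0: "abs_weil_space p = 0 \<longleftrightarrow> p \<in> free_span weil_relations"
  by (simp add: zero_weil_space_def abs_weil_space_eq)

lemma abs_weil_space_add: "abs_weil_space (p + q) = abs_weil_space p + abs_weil_space q"
  by (simp add: plus_weil_space.abs_eq)

lemma abs_weil_space_diff: "abs_weil_space (p - q) = abs_weil_space p - abs_weil_space q"
  by (simp add: minus_weil_space.abs_eq)

lemma abs_weil_space_smult: "abs_weil_space (smult c p) = scaleW c (abs_weil_space p)"
  by (simp add: scaleW.abs_eq)

lemma abs_weil_space_0: "abs_weil_space 0 = 0"
  by (simp add: zero_weil_space_def)

lemma abs_weil_space_gen: "abs_weil_space (gen D) = weil_class D"
  by (simp add: weil_class_def)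

lemma abs_weil_space_sum: "abs_weil_space (sum f A) = (\<Sum>x\<in>A. abs_weil_space (f x))"
  by (induction A rule: infinite_finite_induct)
    (simp_all add: abs_weil_space_add abs_weil_space_0)

lemma abs_weil_space_sum_list: "abs_weil_space (\<Sum>x\<leftarrow>xs. f x) = (\<Sum>x\<leftarrow>xs. abs_weil_space (f x))"
  by (induction xs) (simp_all add: abs_weil_space_add abs_weil_space_0)

lemmas abs_weil_space_simps = abs_weil_space_add abs_weil_space_diff abs_weil_space_smult
  abs_weil_space_0 abs_weil_space_gen abs_weil_space_sum abs_weil_space_sum_list

lemma weil_class_iso:
  assumes "weil_diagram D" "weil_diagram D'" "weil_iso f D D'"
  shows "weil_class D = weil_class D'"
  unfolding abs_weil_space_gen[symmetric] abs_weil_space_eq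
  by (rule free.span_base) (use assms in \<open>auto simp: weil_relations_def\<close>)

lemma weil_class_local:
  assumes "local_relation Gs" "\<And>G. G \<in> set Gs \<Longrightarrow> weil_diagram (Weil G ls s)"
  shows "(\<Sum>G\<leftarrow>Gs. weil_class (Weil G ls s)) = 0"
proof -
  have "abs_weil_space (\<Sum>G\<leftarrow>Gs. gen (Weil G ls s)) = 0"
    unfolding abs_weil_space_eq_0
    by (rule free.span_base) (use assms in \<open>auto simp: weil_relations_def\<close>)
  then show ?thesis by (simp add: abs_weil_space_simps)
qed

lemma weil_class_perm:
  assumes "weil_diagram (Weil G (xs @ [(k, x), (l, y)] @ ys) s)"
  shows "weil_class (Weil G (xs @ [(k, x), (l, y)] @ ys) s)
    = scaleW ((-1) ^ (x * y)) (weil_class (Weil G (xs @ [(l, y), (k, x)] @ ys) s))"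
proof -
  have "abs_weil_space (gen (Weil G (xs @ [(k, x), (l, y)] @ ys) s)
    - smult ((-1) ^ (x * y)) (gen (Weil G (xs @ [(l, y), (k, x)] @ ys) s))) = 0"
    unfolding abs_weil_space_eq_0
    by (rule free.span_base) (use assms in \<open>unfold weil_relations_def, blast\<close>)
  then show ?thesis by (simp add: abs_weil_space_simps)
qed

lemma weil_diagram_mset:
  assumes "mset ls = mset ls'"
  shows "weil_diagram (Weil G ls s) = weil_diagram (Weil G ls' s)"
proof -
  have "set ls = set ls'"
    using assms by (rule mset_eq_setD)
  moreover have "mset (map fst ls) = mset (map fst ls')"
    using assms by simp
  then have "distinct (map fst ls) = distinct (map fst ls')"
    by (rule mset_eq_imp_distinct_iff)
  ultimately show ?thesis by (simp add: weil_diagram_def)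
qed

lemma weil_class_move:
  assumes "weil_diagram (Weil G (xs @ a # zs @ ws) s)"
  shows "weil_class (Weil G (xs @ a # zs @ ws) s)
    = scaleW ((-1) ^ (snd a * sum_list (map snd zs))) (weil_class (Weil G (xs @ zs @ a # ws) s))"
  using assms
proof (induction zs arbitrary: xs)
  case Nil
  then show ?case by simp
next
  case (Cons z zs)
  have *: "weil_diagram (Weil G ((xs @ [z]) @ a # zs @ ws) s)"
    using Cons.prems by (subst weil_diagram_mset) auto
  have "weil_class (Weil G (xs @ a # (z # zs) @ ws) s)
    = scaleW ((-1) ^ (snd a * snd z)) (weil_class (Weil G ((xs @ [z]) @ a # zs @ ws) s))"
    using weil_class_perm[of G xs "fst a" "snd a" "fst z" "snd z" "zs @ ws" s] Cons.prems by simp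
  also note Cons.IH[OF *]
  finally show ?case
    by (simp add: weil.scale_scale power_add[symmetric] algebra_simps)
qed

lemma weil_class_swap_blocks:
  assumes "weil_diagram (Weil G (xs @ ys @ zs @ ws) s)"
  shows "weil_class (Weil G (xs @ ys @ zs @ ws) s)
    = scaleW ((-1) ^ (sum_list (map snd ys) * sum_list (map snd zs)))
        (weil_class (Weil G (xs @ zs @ ys @ ws) s))"
  using assms
proof (induction ys arbitrary: xs)
  case Nil
  then show ?case by simp
next
  case (Cons a ys)
  have "weil_class (Weil G (xs @ (a # ys) @ zs @ ws) s)
    = scaleW ((-1) ^ (sum_list (map snd ys) * sum_list (map snd zs)))
        (weil_class (Weil G (xs @ a # zs @ ys @ ws) s))"
    using Cons.IH[of "xs @ [a]"] Cons.prems by simp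
  also have "weil_class (Weil G (xs @ a # zs @ ys @ ws) s)
    = scaleW ((-1) ^ (snd a * sum_list (map snd zs))) (weil_class (Weil G (xs @ zs @ a # ys @ ws) s))"
    by (rule weil_class_move) (use Cons.prems in \<open>subst weil_diagram_mset, auto\<close>)
  finally show ?case
    by (simp add: weil.scale_scale power_add[symmetric] algebra_simps)
qed


section \<open>Insertion of trivalent vertices\<close>

lemma univalentD: "h \<in> univalent G \<Longrightarrow> h \<in> half_edges G \<and> rot G h = h"
  by (simp add: univalent_def)

lemma rot_in_univalent:
  assumes "unitrivalent G" "h \<in> half_edges G" "rot G h \<in> univalent G"
  shows "rot G h = h"
  using assms unfolding unitrivalent_def univalent_def by (metis (mono_tags, lifting) mem_Collect_eq)

lemma unitrivalent_sprout:
  assumes G: "unitrivalent G" and S: "S \<subseteq> univalent G"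
  shows "unitrivalent (sprout S G)"
proof -
  have "finite S"
    using assms by (auto simp: unitrivalent_def univalent_def intro: finite_subset)
  moreover have "rot G h \<notin> S" if "h \<in> half_edges G" "h \<notin> S" for h
    using rot_in_univalent[OF G] S that by fastforce
  moreover have "h \<in> half_edges G" "rot G h = h" if "h \<in> S" for h
    using S that by (auto simp: univalent_def)
  ultimately show ?thesis
    using G unfolding unitrivalent_def by (auto simp: sprout_def)
qed

lemma univalent_sprout:
  assumes "S \<subseteq> univalent G"
  shows "univalent (sprout S G) = Old ` (univalent G - S) \<union> EndL ` S \<union> EndR ` S"
  using assms by (auto simp: univalent_def sprout_def split: if_splits)

fun lift_iso :: "(half_edge \<Rightarrow> half_edge) \<Rightarrow> half_edge \<Rightarrow> half_edge" where
  "lift_iso f (Old h) = Old (f h)"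
| "lift_iso f (ForkL h) = ForkL (f h)"
| "lift_iso f (ForkR h) = ForkR (f h)"
| "lift_iso f (EndL h) = EndL (f h)"
| "lift_iso f (EndR h) = EndR (f h)"
| "lift_iso f h = h"

lemma graph_iso_sprout:
  assumes f: "graph_iso f G G'" and S: "S \<subseteq> univalent G"
  shows "graph_iso (lift_iso f) (sprout S G) (sprout (f ` S) G')"
proof -
  have inj: "f x = f y \<longleftrightarrow> x = y" if "x \<in> half_edges G" "y \<in> half_edges G" for x y
    using f that by (auto simp: graph_iso_def bij_betw_def inj_on_def)
  have SH: "x \<in> half_edges G" if "x \<in> S" for x
    using S that by (auto simp: univalent_def)
  have mem: "f x \<in> f ` S \<longleftrightarrow> x \<in> S" if "x \<in> half_edges G" for x
    using inj that SH by auto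
  have "inj_on (lift_iso f) (half_edges (sprout S G))"
    by (rule inj_onI) (auto simp: sprout_def inj SH)
  moreover have "lift_iso f ` half_edges (sprout S G) = half_edges (sprout (f ` S) G')"
  proof -
    have "half_edges G' = f ` half_edges G"
      using f by (auto simp: graph_iso_def bij_betw_def)
    then show ?thesis
      by (simp add: sprout_def image_Un image_image)
  qed
  ultimately have "bij_betw (lift_iso f) (half_edges (sprout S G)) (half_edges (sprout (f ` S) G'))"
    by (simp add: bij_betw_def)
  moreover have "lift_iso f (rot (sprout S G) h) = rot (sprout (f ` S) G') (lift_iso f h) \<and>
      lift_iso f (opp (sprout S G) h) = opp (sprout (f ` S) G') (lift_iso f h)"
    if "h \<in> half_edges (sprout S G)" for h
    using that f by (auto simp: sprout_def graph_iso_def mem SH)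
  ultimately show ?thesis
    unfolding graph_iso_def by blast
qed

lemma sprout_reverse_at:
  assumes "S \<subseteq> univalent G" "unitrivalent G" "h \<in> half_edges G" "rot G h \<noteq> h"
  shows "sprout S (reverse_at h G) = reverse_at (Old h) (sprout S G)"
proof -
  have 1: "h \<notin> S"
    using assms by (auto simp: univalent_def)
  have 2: "rot G h \<notin> S"
    using rot_in_univalent[of G h] assms by auto
  have 3: "rot G (rot G h) \<notin> S"
    using assms unfolding univalent_def unitrivalent_def
    by (smt (verit) mem_Collect_eq subset_eq)
  have 4: "rot G (rot G (rot G h)) = h"
    using assms by (auto simp: unitrivalent_def)
  have "sprout_rot S (reverse_at h G) x = rot (reverse_at (Old h) (sprout S G)) x" for x
    by (cases x) (auto simp: reverse_at_def sprout_def 1 2 3 4)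
  moreover have "sprout_opp (reverse_at h G) x = sprout_opp G x" for x
    by (cases x) (auto simp: reverse_at_def)
  ultimately show ?thesis
    by (simp add: sprout_def reverse_at_def fun_eq_iff)
qed

lemma sprout_tree_T:
  assumes "{u, v, a, b, c, e} \<inter> S = {}"
  shows "sprout S (tree_T G u v a b c e)
    = tree_T (sprout S G) (Old u) (Old v) (Old a) (Old b) (Old c) (Old e)"
proof -
  have "sprout_rot S (tree_T G u v a b c e) x
      = rot (tree_T (sprout S G) (Old u) (Old v) (Old a) (Old b) (Old c) (Old e)) x" for x
    using assms by (cases x) (auto simp: tree_T_def sprout_def)
  moreover have "sprout_opp (tree_T G u v a b c e) x = sprout_opp G x" for x
    by (cases x) (auto simp: tree_T_def)
  ultimately show ?thesis
    by (simp add: sprout_def tree_T_def fun_eq_iff)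
qed

lemma tree_T_self:
  assumes "rot G a = b" "rot G b = u" "rot G u = a" "rot G v = c" "rot G c = e" "rot G e = v"
  shows "tree_T G u v a b c e = G"
  using assms by (auto simp: tree_T_def fun_upd_idem_iff intro!: ugraph.equality)

lemma local_relation_univalent:
  assumes "local_relation Gs" "\<And>G. G \<in> set Gs \<Longrightarrow> unitrivalent G" "G \<in> set Gs" "G' \<in> set Gs"
  shows "univalent G = univalent G'"
proof -
  have "\<exists>U. \<forall>G\<in>set Gs. univalent G = U"
    using assms(1,2)
  proof cases
    case (AS h G)
    have "unitrivalent G" using AS assms(2) by simp
    then have "univalent (reverse_at h G) = univalent G"
      unfolding univalent_def reverse_at_def unitrivalent_def
      by (auto split: if_splits)
    then show ?thesis using AS by auto
  next
    case (self_loop h G)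
    then show ?thesis by auto
  next
    case (IHX u v a b c e G)
    have "tree_T G u v a b c e = G"
      by (rule tree_T_self) (use IHX in auto)
    moreover have "rot (tree_T G u v b c a e) x = x \<longleftrightarrow> rot G x = x"
      "rot (tree_T G u v c a b e) x = x \<longleftrightarrow> rot G x = x" for x
      using IHX(3,5-) by (auto simp: tree_T_def)
    then have "univalent (tree_T G u v b c a e) = univalent G"
      "univalent (tree_T G u v c a b e) = univalent G"
      by (simp_all only: univalent_def) (simp_all add: tree_T_def)
    ultimately show ?thesis
      unfolding IHX(1) by simp
  qed
  then show ?thesis using assms(3,4) by auto
qed

lemma local_relation_sprout:
  assumes "local_relation Gs" and uni: "\<And>G. G \<in> set Gs \<Longrightarrow> unitrivalent G"
    and S: "\<And>G. G \<in> set Gs \<Longrightarrow> S \<subseteq> univalent G"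
  shows "local_relation (map (sprout S) Gs)"
  using assms(1)
proof cases
  case (AS h G)
  have "h \<notin> S"
    using S[of G] AS by (auto simp: univalent_def)
  moreover have "sprout S (reverse_at h G) = reverse_at (Old h) (sprout S G)"
    by (rule sprout_reverse_at) (use S uni AS in auto)
  ultimately show ?thesis
    using AS by (auto intro!: local_relation.AS simp: sprout_def)
next
  case (self_loop h G)
  have "h \<notin> S"
    using S[of G] self_loop by (auto simp: univalent_def)
  then show ?thesis
    using self_loop by (auto intro!: local_relation.self_loop simp: sprout_def)
next
  case (IHX u v a b c e G)
  have G: "tree_T G u v a b c e = G"
    by (rule tree_T_self) (use IHX in auto)
  have "G \<in> set Gs"
    using IHX G by simp
  then have "S \<subseteq> univalent G"
    by (rule S)
  then have disj: "{u, v, a, b, c, e} \<inter> S = {}"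
    using IHX by (auto simp: univalent_def)
  have "map (sprout S) Gs =
     [tree_T (sprout S G) (Old u) (Old v) (Old a) (Old b) (Old c) (Old e),
      tree_T (sprout S G) (Old u) (Old v) (Old b) (Old c) (Old a) (Old e),
      tree_T (sprout S G) (Old u) (Old v) (Old c) (Old a) (Old b) (Old e)]"
    using disj IHX(1) by (simp add: sprout_tree_T insert_commute)
  moreover have "local_relation \<dots>"
    by (rule local_relation.IHX) (use IHX disj in \<open>auto simp: sprout_def\<close>)
  ultimately show ?thesis by simp
qed


section \<open>Operators given by leg substitution rules\<close>

text \<open>Here \<open>rule k D\<close> is the result of the replacement of the \<open>k\<close>-th leg of \<open>D\<close>.\<close>

definition leg_operator :: "int \<Rightarrow> (nat \<Rightarrow> weil \<Rightarrow> weil free) \<Rightarrow> weil \<Rightarrow> weil free" where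
  "leg_operator j rule D = (\<Sum>k<length (legs D).
     smult ((-1) powi (j * int (sum_list (map snd (take k (legs D)))))) (rule k D))"

lemma power_minus_one_cases: "(-1::rat) ^ n = 1 \<or> (-1::rat) ^ n = -1"
  by (induction n) auto

lemma minus_one_power_square: "(-1::rat) ^ n * (-1) ^ n = 1"
  using power_minus_one_cases[of n] by auto

lemma minus_one_powi_add: "(-1::rat) powi (j * (a + b)) = (-1) powi (j * a) * (-1) powi (j * b)"
  by (simp add: distrib_left power_int_add)

lemma sum_lessThan_split2:
  fixes f :: "nat \<Rightarrow> 'a::comm_monoid_add"
  shows "(\<Sum>i<m + 2 + n. f i) = (\<Sum>i<m. f i) + (f m + f (Suc m)) + (\<Sum>i<n. f (m + 2 + i))"
  by (induction n) (simp_all add: algebra_simps)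

text \<open>A criterion for a leg substitution rule to be compatible with the relations.\<close>

lemma leg_operator_relations:
  assumes iso: "\<And>D D' f k. \<lbrakk>weil_diagram D; weil_diagram D'; weil_iso f D D'; k < length (legs D)\<rbrakk>
      \<Longrightarrow> abs_weil_space (rule k D) = abs_weil_space (rule k D')"
    and loc: "\<And>Gs ls s k. \<lbrakk>local_relation Gs; \<And>G. G \<in> set Gs \<Longrightarrow> weil_diagram (Weil G ls s);
        k < length ls\<rbrakk> \<Longrightarrow> (\<Sum>G\<leftarrow>Gs. abs_weil_space (rule k (Weil G ls s))) = 0"
    and other: "\<And>G xs k x l y ys s i.
        \<lbrakk>weil_diagram (Weil G (xs @ [(k, x), (l, y)] @ ys) s);
         i < length xs \<or> (length xs + 2 \<le> i \<and> i < length xs + 2 + length ys)\<rbrakk>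
        \<Longrightarrow> abs_weil_space (rule i (Weil G (xs @ [(k, x), (l, y)] @ ys) s))
          = scaleW ((-1) ^ (x * y)) (abs_weil_space (rule i (Weil G (xs @ [(l, y), (k, x)] @ ys) s)))"
    and swap: "\<And>G xs k x l y ys s. weil_diagram (Weil G (xs @ [(k, x), (l, y)] @ ys) s)
        \<Longrightarrow> abs_weil_space (rule (length xs) (Weil G (xs @ [(k, x), (l, y)] @ ys) s))
          = scaleW ((-1) powi (j * int y) * (-1) ^ (x * y))
              (abs_weil_space (rule (Suc (length xs)) (Weil G (xs @ [(l, y), (k, x)] @ ys) s)))"
    and r: "r \<in> weil_relations"
  shows "lin_ext (leg_operator j rule) r \<in> free_span weil_relations"
proof -
  let ?sg = "\<lambda>ls k. (-1::rat) powi (j * int (sum_list (map snd (take k ls))))"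
  have op: "abs_weil_space (leg_operator j rule (Weil G ls s))
      = (\<Sum>k<length ls. scaleW (?sg ls k) (abs_weil_space (rule k (Weil G ls s))))" for G ls s
    by (simp add: leg_operator_def abs_weil_space_simps)
  consider (iso) D D' f where "r = gen D - gen D'" "weil_diagram D" "weil_diagram D'" "weil_iso f D D'"
    | (loc) Gs ls s where "r = (\<Sum>G\<leftarrow>Gs. gen (Weil G ls s))" "local_relation Gs"
        "\<And>G. G \<in> set Gs \<Longrightarrow> weil_diagram (Weil G ls s)"
    | (perm) G xs k x l y ys s where
        "r = gen (Weil G (xs @ [(k, x), (l, y)] @ ys) s)
          - smult ((-1) ^ (x * y)) (gen (Weil G (xs @ [(l, y), (k, x)] @ ys) s))"
        "weil_diagram (Weil G (xs @ [(k, x), (l, y)] @ ys) s)"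
    using r unfolding weil_relations_def by blast
  then have "abs_weil_space (lin_ext (leg_operator j rule) r) = 0"
  proof cases
    case iso
    obtain G ls s G' ls' s' where D: "D = Weil G ls s" "D' = Weil G' ls' s'"
      by (meson weil.exhaust)
    have ls': "ls' = map (apfst f) ls"
      using iso(4) by (simp add: D weil_iso_def)
    have [simp]: "length ls' = length ls" "map snd (take k ls') = map snd (take k ls)" for k
      by (simp_all add: ls' take_map)
    have "abs_weil_space (rule k D) = abs_weil_space (rule k D')" if "k < length ls" for k
      using assms(1)[OF iso(2-4)] that by (simp add: D)
    then show ?thesis
      unfolding iso(1) by (simp add: lin_ext.diff abs_weil_space_simps op D)
  next
    case loc
    have "abs_weil_space (lin_ext (leg_operator j rule) r)
        = (\<Sum>G\<leftarrow>Gs. \<Sum>k<length ls. scaleW (?sg ls k) (abs_weil_space (rule k (Weil G ls s))))"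
      unfolding loc(1) by (simp add: lin_ext_sum_list abs_weil_space_simps op o_def)
    also have "\<dots> = (\<Sum>k<length ls. scaleW (?sg ls k) (\<Sum>G\<leftarrow>Gs. abs_weil_space (rule k (Weil G ls s))))"
      by (induction Gs) (simp_all add: sum.distrib weil.scale_right_distrib)
    also have "\<dots> = 0"
      using assms(2)[OF loc(2,3)] by simp
    finally show ?thesis .
  next
    case perm
    let ?L = "xs @ [(k, x), (l, y)] @ ys" and ?L' = "xs @ [(l, y), (k, x)] @ ys"
    let ?R = "\<lambda>ls i. abs_weil_space (rule i (Weil G ls s))"
    let ?m = "length xs" and ?e = "(-1::rat) ^ (x * y)"
    let ?X = "int (sum_list (map snd xs))"
    have valid': "weil_diagram (Weil G ?L' s)"
      using perm(2) by (subst weil_diagram_mset[where ls' = ?L]) auto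
    have ee: "?e * ?e = 1"
      by (rule minus_one_power_square)
    have "scaleW (?sg ?L i) (?R ?L i) = scaleW ?e (scaleW (?sg ?L' i) (?R ?L' i))" if "i < ?m" for i
      using other[OF perm(2), of i] that by (simp add: weil.scale_scale mult.commute)
    then have 1: "(\<Sum>i<?m. scaleW (?sg ?L i) (?R ?L i))
        = scaleW ?e (\<Sum>i<?m. scaleW (?sg ?L' i) (?R ?L' i))"
      by (simp add: weil.scale_sum_right)
    have "scaleW (?sg ?L (?m + 2 + i)) (?R ?L (?m + 2 + i))
        = scaleW ?e (scaleW (?sg ?L' (?m + 2 + i)) (?R ?L' (?m + 2 + i)))" if "i < length ys" for i
    proof -
      have "?sg ?L (?m + 2 + i) = ?sg ?L' (?m + 2 + i)"
        by (simp add: add_ac)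
      then show ?thesis
        using other[OF perm(2), of "?m + 2 + i"] that by (simp add: weil.scale_scale mult.commute)
    qed
    then have 2: "(\<Sum>i<length ys. scaleW (?sg ?L (?m + 2 + i)) (?R ?L (?m + 2 + i)))
        = scaleW ?e (\<Sum>i<length ys. scaleW (?sg ?L' (?m + 2 + i)) (?R ?L' (?m + 2 + i)))"
      by (simp add: weil.scale_sum_right)
    have sg: "?sg ?L ?m = (-1) powi (j * ?X)" "?sg ?L' ?m = (-1) powi (j * ?X)"
      "?sg ?L (Suc ?m) = (-1) powi (j * ?X) * (-1) powi (j * int x)"
      "?sg ?L' (Suc ?m) = (-1) powi (j * ?X) * (-1) powi (j * int y)"
      by (simp_all add: minus_one_powi_add)
    have "scaleW (?sg ?L ?m) (?R ?L ?m) = scaleW ?e (scaleW (?sg ?L' (Suc ?m)) (?R ?L' (Suc ?m)))"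
      unfolding sg swap[OF perm(2)] weil.scale_scale by (simp add: mult_ac)
    moreover have "scaleW ?e (scaleW (?sg ?L' ?m) (?R ?L' ?m)) = scaleW (?sg ?L (Suc ?m)) (?R ?L (Suc ?m))"
      unfolding sg swap[OF valid'] weil.scale_scale
      using ee by (simp add: mult_ac)
    ultimately have 3: "scaleW (?sg ?L ?m) (?R ?L ?m) + scaleW (?sg ?L (Suc ?m)) (?R ?L (Suc ?m))
        = scaleW ?e (scaleW (?sg ?L' ?m) (?R ?L' ?m) + scaleW (?sg ?L' (Suc ?m)) (?R ?L' (Suc ?m)))"
      by (simp add: weil.scale_right_distrib)
    have len: "length ?L = ?m + 2 + length ys" "length ?L' = ?m + 2 + length ys"
      by simp_all
    have "abs_weil_space (leg_operator j rule (Weil G ?L s))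
        = scaleW ?e (abs_weil_space (leg_operator j rule (Weil G ?L' s)))"
      unfolding op len sum_lessThan_split2 1 2 3 by (simp only: weil.scale_right_distrib)
    then show ?thesis
      unfolding perm(1) by (simp add: lin_ext.diff lin_ext_smult abs_weil_space_simps)
  qed
  then show ?thesis
    by (simp only: abs_weil_space_eq_0)
qed

fun d_rule :: "nat \<Rightarrow> weil \<Rightarrow> weil free" where
  "d_rule k (Weil G ls s) =
     (if snd (ls ! k) = 1 then gen (Weil G (ls[k := (fst (ls ! k), 2)]) s) else 0)"

text \<open>The map \<open>\<iota>\<close> is only of interest on diagrams without special vertex; on the others it is
  set to 0.\<close>

fun iota_rule :: "nat \<Rightarrow> weil \<Rightarrow> weil free" where
  "iota_rule k (Weil G ls (Some s)) = 0"
| "iota_rule k (Weil G ls None) =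
     (let (h, g) = ls ! k in
      if g = 1 then gen (Weil G (take k ls @ drop (Suc k) ls) (Some h))
      else gen (Weil (sprout {h} G) ((map (apfst Old) ls)[k := (EndR h, 1)]) (Some (EndL h))))"

lemma weil_diagram_d:
  assumes "weil_diagram (Weil G ls s)" "k < length ls"
  shows "weil_diagram (Weil G (ls[k := (fst (ls ! k), 2)]) s)"
proof -
  have fst: "map fst (ls[k := (fst (ls ! k), 2)]) = map fst ls"
    using assms(2) by (auto simp: list_eq_iff_nth_eq nth_list_update)
  moreover have "snd ` set (ls[k := (fst (ls ! k), 2)]) \<subseteq> {1, 2}"
  proof -
    have "snd ` set (ls[k := (fst (ls ! k), 2)]) \<subseteq> snd ` insert (fst (ls ! k), 2) (set ls)"
      by (intro image_mono set_update_subset_insert)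
    also have "\<dots> = insert 2 (snd ` set ls)"
      by simp
    also have "\<dots> \<subseteq> {1, 2}"
      using assms(1) by (simp add: weil_diagram_def)
    finally show ?thesis .
  qed
  moreover have "fst ` set (ls[k := (fst (ls ! k), 2)]) = fst ` set ls"
    using fst by (metis set_map)
  ultimately show ?thesis
    using assms(1) by (simp add: weil_diagram_def)
qed

lemma split_nth:
  assumes "k < length ls"
  obtains us h g vs where "ls = us @ (h, g) # vs" "length us = k"
  using assms id_take_nth_drop[of k ls] by (metis length_take min.absorb4 surj_pair)

lemma weil_diagram_iota1:
  assumes "weil_diagram (Weil G (us @ (h, g) # vs) None)"
  shows "weil_diagram (Weil G (us @ vs) (Some h))"
  using assms by (auto simp: weil_diagram_def)

lemma weil_diagram_iota2:
  assumes "weil_diagram (Weil G (us @ (h, g) # vs) None)"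
  shows "weil_diagram (Weil (sprout {h} G)
    (map (apfst Old) us @ (EndR h, 1) # map (apfst Old) vs) (Some (EndL h)))"
proof -
  let ?ls = "us @ (h, g) # vs"
  have uni: "unitrivalent G" and univ: "fst ` set ?ls = univalent G"
    and dist: "distinct (map fst ?ls)" and gr: "snd ` set ?ls \<subseteq> {1, 2}"
    using assms by (auto simp: weil_diagram_def)
  have h: "{h} \<subseteq> univalent G"
    using univ by auto
  have "univalent G - {h} = fst ` set us \<union> fst ` set vs"
    using univ dist by auto
  then have u: "univalent (sprout {h} G) = Old ` (fst ` set us \<union> fst ` set vs) \<union> {EndL h, EndR h}"
    using univalent_sprout[OF h] by auto
  have f: "map fst (map (apfst Old) xs) = map Old (map fst xs)" for xs :: "(half_edge \<times> nat) list"
    by (simp add: o_def)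
  have "distinct (map fst (map (apfst Old) us @ (EndR h, 1) # map (apfst Old) vs))"
    using dist unfolding map_append list.map f by (auto simp: distinct_map inj_on_def)
  then show ?thesis
    using unitrivalent_sprout[OF uni h] gr
    unfolding weil_diagram_def by (auto simp: u image_Un image_image)
qed

lemma iota_rule_nth:
  "iota_rule (length us) (Weil G (us @ (h, g) # vs) None) =
     (if g = 1 then gen (Weil G (us @ vs) (Some h))
      else gen (Weil (sprout {h} G)
        (map (apfst Old) us @ (EndR h, 1) # map (apfst Old) vs) (Some (EndL h))))"
  using list_update_length[of "map (apfst Old) us"] by simp

lemma d_rule_nth:
  "d_rule (length us) (Weil G (us @ (h, g) # vs) s) =
     (if g = 1 then gen (Weil G (us @ (h, 2) # vs) s) else 0)"
  by simp

lemma d_relations: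
  assumes "r \<in> weil_relations"
  shows "lin_ext (leg_operator 1 d_rule) r \<in> free_span weil_relations"
proof (rule leg_operator_relations[OF _ _ _ _ assms])
  fix D D' f k
  assume D: "weil_diagram D" "weil_diagram D'" "weil_iso f D D'" "k < length (legs D)"
  obtain G ls s G' ls' s' where D': "D = Weil G ls s" "D' = Weil G' ls' s'"
    by (meson weil.exhaust)
  have ls': "ls' = map (apfst f) ls"
    using D by (simp add: D' weil_iso_def)
  have k: "k < length ls"
    using D by (simp add: D')
  have "weil_class (Weil G (ls[k := (fst (ls ! k), 2)]) s)
      = weil_class (Weil G' (ls'[k := (fst (ls' ! k), 2)]) s')"
  proof (rule weil_class_iso[of _ _ f])
    show "weil_diagram (Weil G (ls[k := (fst (ls ! k), 2)]) s)"
      using D k by (simp add: D' weil_diagram_d)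
    show "weil_diagram (Weil G' (ls'[k := (fst (ls' ! k), 2)]) s')"
      using D k by (intro weil_diagram_d) (simp_all add: D' ls')
    show "weil_iso f (Weil G (ls[k := (fst (ls ! k), 2)]) s)
      (Weil G' (ls'[k := (fst (ls' ! k), 2)]) s')"
      using D k by (simp add: D' ls' weil_iso_def map_update)
  qed
  then show "abs_weil_space (d_rule k D) = abs_weil_space (d_rule k D')"
    using k by (simp add: D' ls' abs_weil_space_simps)
next
  fix Gs ls s k
  assume *: "local_relation Gs" "\<And>G. G \<in> set Gs \<Longrightarrow> weil_diagram (Weil G ls s)" "k < length ls"
  have "(\<Sum>G\<leftarrow>Gs. weil_class (Weil G (ls[k := (fst (ls ! k), 2)]) s)) = 0"
    by (rule weil_class_local) (use * in \<open>auto intro: weil_diagram_d\<close>)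
  then show "(\<Sum>G\<leftarrow>Gs. abs_weil_space (d_rule k (Weil G ls s))) = 0"
    by (cases "snd (ls ! k) = 1") (simp_all add: abs_weil_space_0 abs_weil_space_gen)
next
  fix G xs k x l y ys s i
  assume D: "weil_diagram (Weil G (xs @ [(k, x), (l, y)] @ ys) s)"
    and i: "i < length xs \<or> (length xs + 2 \<le> i \<and> i < length xs + 2 + length ys)"
  let ?L = "xs @ [(k, x), (l, y)] @ ys" and ?L' = "xs @ [(l, y), (k, x)] @ ys"
  show "abs_weil_space (d_rule i (Weil G ?L s))
      = scaleW ((-1) ^ (x * y)) (abs_weil_space (d_rule i (Weil G ?L' s)))"
  proof (cases "i < length xs")
    case True
    then obtain us h g vs where xs: "xs = us @ (h, g) # vs" and i': "i = length us"
      by (metis split_nth)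
    have "weil_diagram (Weil G ((us @ (h, 2) # vs) @ [(k, x), (l, y)] @ ys) s)"
      using weil_diagram_d[OF D, of "length us"] by (simp add: xs)
    note 1 = weil_class_perm[OF this]
    have L: "d_rule i (Weil G (xs @ zs) s)
        = (if g = 1 then gen (Weil G ((us @ (h, 2) # vs) @ zs) s) else 0)" for zs
      using d_rule_nth[of us G h g "vs @ zs" s] by (simp only: xs i' append_assoc append_Cons)
    show ?thesis
      unfolding L using 1 by (cases "g = 1") (simp_all only: refl if_True if_False abs_weil_space_gen
        abs_weil_space_0 weil.scale_zero_right)
  next
    case False
    then obtain i' where "i = length xs + 2 + i'" "i' < length ys"
      using i by (metis le_iff_add nat_add_left_cancel_less)
    then obtain us h g vs where ys: "ys = us @ (h, g) # vs" and i': "i = length xs + 2 + length us"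
      by (metis split_nth)
    have "weil_diagram (Weil G (xs @ [(k, x), (l, y)] @ (us @ (h, 2) # vs)) s)"
      using weil_diagram_d[OF D, of i] by (simp add: ys i' list_update_append nth_append)
    note 1 = weil_class_perm[OF this]
    have L: "d_rule i (Weil G (xs @ [p, q] @ ys) s)
        = (if g = 1 then gen (Weil G (xs @ [p, q] @ (us @ (h, 2) # vs)) s) else 0)" for p q
      using d_rule_nth[of "xs @ [p, q] @ us" G h g vs s] by (simp add: ys i')
    show ?thesis
      unfolding L using 1 by (cases "g = 1") (simp_all only: refl if_True if_False abs_weil_space_gen
        abs_weil_space_0 weil.scale_zero_right)
  qed
next
  fix G xs k x l y ys s
  assume D: "weil_diagram (Weil G (xs @ [(k, x), (l, y)] @ ys) s)"
  have "weil_diagram (Weil G (xs @ [(k, 2), (l, y)] @ ys) s)"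
    using weil_diagram_d[OF D, of "length xs"] by simp
  from weil_class_perm[OF this]
  have "weil_class (Weil G (xs @ [(k, 2), (l, y)] @ ys) s)
      = weil_class (Weil G (xs @ [(l, y), (k, 2)] @ ys) s)"
    by simp
  then show "abs_weil_space (d_rule (length xs) (Weil G (xs @ [(k, x), (l, y)] @ ys) s))
      = scaleW ((-1) powi (1 * int y) * (-1) ^ (x * y))
          (abs_weil_space (d_rule (Suc (length xs)) (Weil G (xs @ [(l, y), (k, x)] @ ys) s)))"
    using d_rule_nth[of xs G k x "(l, y) # ys" s] d_rule_nth[of "xs @ [(l, y)]" G k x ys s]
    by (auto simp: abs_weil_space_simps minus_one_power_square)
qed

lemma iota_relations:
  assumes "r \<in> weil_relations"
  shows "lin_ext (leg_operator (-1) iota_rule) r \<in> free_span weil_relations"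
proof (rule leg_operator_relations[OF _ _ _ _ assms])
  fix D D' f k
  assume D: "weil_diagram D" "weil_diagram D'" "weil_iso f D D'" "k < length (legs D)"
  obtain G ls s G' ls' s' where D': "D = Weil G ls s" "D' = Weil G' ls' s'"
    by (meson weil.exhaust)
  have ls': "ls' = map (apfst f) ls" and s': "s' = map_option f s" and f: "graph_iso f G G'"
    using D by (simp_all add: D' weil_iso_def)
  show "abs_weil_space (iota_rule k D) = abs_weil_space (iota_rule k D')"
  proof (cases s)
    case (Some h)
    then show ?thesis by (simp add: D' s')
  next
    case None
    obtain us h g vs where ls: "ls = us @ (h, g) # vs" and k: "length us = k"
      using D(4) by (auto simp: D' elim: split_nth)
    have k': "k = length (map (apfst f) us)"
      using k by simp
    have G: "weil_diagram (Weil G (us @ (h, g) # vs) None)"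
      "weil_diagram (Weil G' (map (apfst f) us @ (f h, g) # map (apfst f) vs) None)"
      using D by (simp_all add: D' ls' s' ls None)
    have 1: "weil_class (Weil G (us @ vs) (Some h))
      = weil_class (Weil G' (map (apfst f) us @ map (apfst f) vs) (Some (f h)))"
      by (rule weil_class_iso[of _ _ f])
        (use G f in \<open>auto simp: weil_iso_def intro: weil_diagram_iota1\<close>)
    have "h \<in> univalent G"
      using G(1) by (auto simp: weil_diagram_def)
    then have "graph_iso (lift_iso f) (sprout {h} G) (sprout {f h} G')"
      using graph_iso_sprout[OF f, of "{h}"] by simp
    then have 2: "weil_class (Weil (sprout {h} G)
        (map (apfst Old) us @ (EndR h, 1) # map (apfst Old) vs) (Some (EndL h)))
      = weil_class (Weil (sprout {f h} G')
        (map (apfst Old) (map (apfst f) us) @ (EndR (f h), 1) # map (apfst Old) (map (apfst f) vs))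
        (Some (EndL (f h))))"
      by (intro weil_class_iso[of _ _ "lift_iso f"] weil_diagram_iota2[OF G(1)]
          weil_diagram_iota2[OF G(2)]) (auto simp: weil_iso_def)
    have "iota_rule k D' =
      (if g = 1 then gen (Weil G' (map (apfst f) us @ map (apfst f) vs) (Some (f h)))
       else gen (Weil (sprout {f h} G')
        (map (apfst Old) (map (apfst f) us) @ (EndR (f h), 1) # map (apfst Old) (map (apfst f) vs))
        (Some (EndL (f h)))))"
      using iota_rule_nth[of "map (apfst f) us" G' "f h" g "map (apfst f) vs"]
      by (simp only: D' ls' ls s' None k' list.map map_append option.map apfst_conv)
    moreover have "iota_rule k D =
      (if g = 1 then gen (Weil G (us @ vs) (Some h))
       else gen (Weil (sprout {h} G)
         (map (apfst Old) us @ (EndR h, 1) # map (apfst Old) vs) (Some (EndL h))))"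
      using iota_rule_nth[of us G h g vs] by (simp only: D' ls None k)
    ultimately show ?thesis
      using 1 2 by (simp only: if_distrib[of abs_weil_space] abs_weil_space_gen)
  qed
next
  fix Gs ls s k
  assume *: "local_relation Gs" "\<And>G. G \<in> set Gs \<Longrightarrow> weil_diagram (Weil G ls s)" "k < length ls"
  show "(\<Sum>G\<leftarrow>Gs. abs_weil_space (iota_rule k (Weil G ls s))) = 0"
  proof (cases s)
    case (Some h)
    then show ?thesis by (simp add: abs_weil_space_0)
  next
    case None
    obtain us h g vs where ls: "ls = us @ (h, g) # vs" and k: "length us = k"
      using *(3) by (auto elim: split_nth)
    have G: "weil_diagram (Weil G (us @ (h, g) # vs) None)" if "G \<in> set Gs" for G
      using *(2)[OF that] by (simp add: ls None)
    have 1: "(\<Sum>G\<leftarrow>Gs. weil_class (Weil G (us @ vs) (Some h))) = 0"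
      by (rule weil_class_local) (use * G in \<open>auto intro: weil_diagram_iota1\<close>)
    have h: "h \<in> univalent G" "unitrivalent G" if "G \<in> set Gs" for G
      using G[OF that] by (auto simp: weil_diagram_def)
    have "local_relation (map (sprout {h}) Gs)"
      by (rule local_relation_sprout[OF *(1)]) (simp_all add: h)
    then have "(\<Sum>G\<leftarrow>map (sprout {h}) Gs. weil_class (Weil G
        (map (apfst Old) us @ (EndR h, 1) # map (apfst Old) vs) (Some (EndL h)))) = 0"
      by (rule weil_class_local) (use G in \<open>auto intro: weil_diagram_iota2 simp del: One_nat_def\<close>)
    then have 2: "(\<Sum>G\<leftarrow>Gs. weil_class (Weil (sprout {h} G)
        (map (apfst Old) us @ (EndR h, 1) # map (apfst Old) vs) (Some (EndL h)))) = 0"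
      by (simp add: o_def)
    show ?thesis
      unfolding ls None k[symmetric] iota_rule_nth using 1 2
      by (cases "g = 1") (simp_all add: abs_weil_space_gen)
  qed
next
  fix G xs k x l y ys s i
  assume D: "weil_diagram (Weil G (xs @ [(k, x), (l, y)] @ ys) s)"
    and i: "i < length xs \<or> (length xs + 2 \<le> i \<and> i < length xs + 2 + length ys)"
  let ?L = "xs @ [(k, x), (l, y)] @ ys" and ?L' = "xs @ [(l, y), (k, x)] @ ys"
  let ?old = "map (apfst Old) :: (half_edge \<times> nat) list \<Rightarrow> _"
  show "abs_weil_space (iota_rule i (Weil G ?L s))
      = scaleW ((-1) ^ (x * y)) (abs_weil_space (iota_rule i (Weil G ?L' s)))"
  proof (cases s)
    case (Some h)
    then show ?thesis by (simp add: abs_weil_space_0)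
  next
    case None
    show ?thesis
    proof (cases "i < length xs")
      case True
      then obtain us h g vs where xs: "xs = us @ (h, g) # vs" and i': "i = length us"
        by (metis split_nth)
      have V: "weil_diagram (Weil G (us @ (h, g) # vs @ [(k, x), (l, y)] @ ys) None)"
        using D by (simp add: xs None)
      have "weil_diagram (Weil G ((us @ vs) @ [(k, x), (l, y)] @ ys) (Some h))"
        using weil_diagram_iota1[OF V] by simp
      note 1 = weil_class_perm[OF this]
      have "weil_diagram (Weil (sprout {h} G)
          ((?old us @ (EndR h, 1) # ?old vs) @ [(Old k, x), (Old l, y)] @ ?old ys) (Some (EndL h)))"
        using weil_diagram_iota2[OF V] by simp
      note 2 = weil_class_perm[OF this]
      have L: "iota_rule i (Weil G (xs @ zs) None)
        = (if g = 1 then gen (Weil G ((us @ vs) @ zs) (Some h))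
           else gen (Weil (sprout {h} G) ((?old us @ (EndR h, 1) # ?old vs) @ ?old zs) (Some (EndL h))))"
        for zs
        using iota_rule_nth[of us G h g "vs @ zs"]
        by (simp only: xs i' append_assoc append_Cons map_append)
      show ?thesis
        unfolding L None using 1 2 by (cases "g = 1") (simp_all only: refl if_True if_False
          abs_weil_space_gen map_append list.map apfst_conv)
    next
      case False
      then obtain i' where "i = length xs + 2 + i'" "i' < length ys"
        using i by (metis le_iff_add nat_add_left_cancel_less)
      then obtain us h g vs where ys: "ys = us @ (h, g) # vs" and i': "i = length xs + 2 + length us"
        by (metis split_nth)
      have V: "weil_diagram (Weil G ((xs @ [(k, x), (l, y)] @ us) @ (h, g) # vs) None)"
        using D by (simp add: ys None)
      have "weil_diagram (Weil G (xs @ [(k, x), (l, y)] @ (us @ vs)) (Some h))"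
        using weil_diagram_iota1[OF V] by simp
      note 1 = weil_class_perm[OF this]
      have "weil_diagram (Weil (sprout {h} G)
          (?old xs @ [(Old k, x), (Old l, y)] @ (?old us @ (EndR h, 1) # ?old vs)) (Some (EndL h)))"
        using weil_diagram_iota2[OF V] by simp
      note 2 = weil_class_perm[OF this]
      have L: "iota_rule i (Weil G (xs @ [p, q] @ ys) None)
        = (if g = 1 then gen (Weil G (xs @ [p, q] @ (us @ vs)) (Some h))
           else gen (Weil (sprout {h} G)
             (?old xs @ [apfst Old p, apfst Old q] @ (?old us @ (EndR h, 1) # ?old vs)) (Some (EndL h))))"
        for p q
        using iota_rule_nth[of "xs @ [p, q] @ us" G h g vs] by (simp add: ys i' del: iota_rule.simps)
      show ?thesis
        unfolding L None using 1 2 by (cases "g = 1") (simp_all only: refl if_True if_False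
          abs_weil_space_gen apfst_conv)
    qed
  qed
next
  fix G xs k x l y ys s
  assume D: "weil_diagram (Weil G (xs @ [(k, x), (l, y)] @ ys) s)"
  let ?old = "map (apfst Old) :: (half_edge \<times> nat) list \<Rightarrow> _"
  show "abs_weil_space (iota_rule (length xs) (Weil G (xs @ [(k, x), (l, y)] @ ys) s))
      = scaleW ((-1) powi (-1 * int y) * (-1) ^ (x * y))
          (abs_weil_space (iota_rule (Suc (length xs)) (Weil G (xs @ [(l, y), (k, x)] @ ys) s)))"
  proof (cases s)
    case (Some h)
    then show ?thesis by (simp add: abs_weil_space_0)
  next
    case None
    have x: "x = 1 \<or> x = 2"
      using D by (auto simp: weil_diagram_def)
    have V: "weil_diagram (Weil G (xs @ (k, x) # (l, y) # ys) None)"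
      using D by (simp add: None)
    have "weil_diagram (Weil (sprout {k} G) (?old xs @ [(EndR k, 1), (Old l, y)] @ ?old ys) (Some (EndL k)))"
      using weil_diagram_iota2[OF V] by simp
    note 2 = weil_class_perm[OF this]
    have sg: "(-1::rat) powi (- int y) = (-1) ^ y"
      using power_minus_one_cases[of y] by (auto simp: power_int_minus)
    show ?thesis
      using x 2 iota_rule_nth[of xs G k x "(l, y) # ys"] iota_rule_nth[of "xs @ [(l, y)]" G k x ys]
      by (auto simp: None abs_weil_space_simps sg minus_one_power_square simp del: iota_rule.simps)
  qed
qed

lemma lin_ext_weil_equiv:
  assumes "\<And>r. r \<in> weil_relations \<Longrightarrow> lin_ext f r \<in> free_span weil_relations" and "weil_equiv p q"
  shows "weil_equiv (lin_ext f p) (lin_ext f q)"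
proof -
  have "lin_ext f (p - q) \<in> free_span weil_relations"
    by (rule lin_ext_span[where R = weil_relations])
      (use assms in \<open>simp_all add: weil_equiv_def\<close>)
  then show ?thesis
    by (simp add: weil_equiv_def lin_ext.diff)
qed

lift_definition d_W :: "weil_space \<Rightarrow> weil_space" is "lin_ext (leg_operator 1 d_rule)"
  by (rule lin_ext_weil_equiv) (rule d_relations)

lift_definition iota_W :: "weil_space \<Rightarrow> weil_space" is "lin_ext (leg_operator (-1) iota_rule)"
  by (rule lin_ext_weil_equiv) (rule iota_relations)

lemma linear_d_W: "Vector_Spaces.linear scaleW scaleW d_W"
  by unfold_locales
    (transfer; simp add: lin_ext_add lin_ext_smult weil_equiv_def free.span_zero)+

lemma linear_iota_W: "Vector_Spaces.linear scaleW scaleW iota_W"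
  by unfold_locales
    (transfer; simp add: lin_ext_add lin_ext_smult weil_equiv_def free.span_zero)+

interpretation d_W: Vector_Spaces.linear scaleW scaleW d_W
  by (rule linear_d_W)

interpretation iota_W: Vector_Spaces.linear scaleW scaleW iota_W
  by (rule linear_iota_W)

lemma d_W_class: "d_W (weil_class D) = abs_weil_space (leg_operator 1 d_rule D)"
  by (simp add: weil_class_def d_W.abs_eq)

lemma iota_W_class: "iota_W (weil_class D) = abs_weil_space (leg_operator (-1) iota_rule D)"
  by (simp add: weil_class_def iota_W.abs_eq)

lemma d_W_grade: "x \<in> W_grade i \<Longrightarrow> d_W x \<in> W_grade (i + 1)"
  unfolding W_grade_def[of i]
proof (induction rule: weil.span_induct_alt)
  case base
  then show ?case by (simp add: W_grade_def weil.span_zero)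
next
  case (step c x y)
  then obtain D where D: "x = weil_class D" "weil_diagram D" "special D = None" "leg_grade D = i"
    by blast
  obtain G ls where "D = Weil G ls None"
    using D(3) by (cases D) simp
  then have x: "x = weil_class (Weil G ls None)"
    and V: "weil_diagram (Weil G ls None)" and i: "leg_grade (Weil G ls None) = i"
    using D by simp_all
  have "abs_weil_space (d_rule k (Weil G ls None)) \<in> W_grade (i + 1)" if k: "k < length ls" for k
  proof -
    obtain us h g vs where ls: "ls = us @ (h, g) # vs" and k': "k = length us"
      using split_nth[OF k] by metis
    have "weil_class (Weil G (us @ (h, 2) # vs) None) \<in> W_grade (i + 1)" if "g = 1"
      unfolding W_grade_def
    proof (rule weil.span_base, intro CollectI exI conjI)
      show "weil_diagram (Weil G (us @ (h, 2) # vs) None)"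
        using weil_diagram_d[OF V k] by (simp add: ls k')
      show "leg_grade (Weil G (us @ (h, 2) # vs) None) = i + 1"
        using i that by (simp add: leg_grade_def ls)
    qed (rule refl, simp)
    then show ?thesis
      unfolding ls k' d_rule_nth
      by (auto simp: abs_weil_space_gen abs_weil_space_0 W_grade_def weil.span_zero)
  qed
  then have "d_W x \<in> W_grade (i + 1)"
    unfolding x d_W_class leg_operator_def W_grade_def abs_weil_space_sum abs_weil_space_smult
    by (intro weil.span_sum weil.span_scale) (simp only: weil.sel lessThan_iff)
  then show ?case
    using step by (simp add: d_W.add d_W.scale W_grade_def weil.span_add weil.span_scale)
qed

lemma iota_W_grade: "x \<in> W_grade i \<Longrightarrow> iota_W x \<in> W_iota_grade (i - 1)"
  unfolding W_grade_def
proof (induction rule: weil.span_induct_alt)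
  case base
  then show ?case by (simp add: W_iota_grade_def weil.span_zero)
next
  case (step c x y)
  then obtain D where D: "x = weil_class D" "weil_diagram D" "special D = None" "leg_grade D = i"
    by blast
  obtain G ls where "D = Weil G ls None"
    using D(3) by (cases D) simp
  then have x: "x = weil_class (Weil G ls None)"
    and V: "weil_diagram (Weil G ls None)" and i: "leg_grade (Weil G ls None) = i"
    using D by simp_all
  have "abs_weil_space (iota_rule k (Weil G ls None)) \<in> W_iota_grade (i - 1)" if k: "k < length ls" for k
  proof -
    obtain us h g vs where ls: "ls = us @ (h, g) # vs" and k': "k = length us"
      using split_nth[OF k] by metis
    have g: "g = 1 \<or> g = 2"
      using V by (auto simp: weil_diagram_def ls)
    have V': "weil_diagram (Weil G (us @ (h, g) # vs) None)"
      using V by (simp add: ls)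
    have 1: "weil_class (Weil G (us @ vs) (Some h)) \<in> W_iota_grade (i - 1)" if "g = 1"
      unfolding W_iota_grade_def
    proof (rule weil.span_base, intro CollectI exI conjI)
      show "weil_diagram (Weil G (us @ vs) (Some h))"
        by (rule weil_diagram_iota1[OF V'])
      show "leg_grade (Weil G (us @ vs) (Some h)) = i - 1"
        using i that by (simp add: leg_grade_def ls)
    qed (rule refl, simp)
    have 2: "weil_class (Weil (sprout {h} G)
        (map (apfst Old) us @ (EndR h, 1) # map (apfst Old) vs) (Some (EndL h)))
        \<in> W_iota_grade (i - 1)" if "g = 2"
      unfolding W_iota_grade_def
    proof (rule weil.span_base, intro CollectI exI conjI)
      show "weil_diagram (Weil (sprout {h} G)
          (map (apfst Old) us @ (EndR h, 1) # map (apfst Old) vs) (Some (EndL h)))"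
        by (rule weil_diagram_iota2[OF V'])
      show "leg_grade (Weil (sprout {h} G)
          (map (apfst Old) us @ (EndR h, 1) # map (apfst Old) vs) (Some (EndL h))) = i - 1"
        using i that by (simp add: leg_grade_def ls o_def)
    qed (rule refl, simp)
    show ?thesis
      unfolding ls k' iota_rule_nth using g 1 2
      by (auto simp: abs_weil_space_gen)
  qed
  then have "iota_W x \<in> W_iota_grade (i - 1)"
    unfolding x iota_W_class leg_operator_def W_iota_grade_def abs_weil_space_sum abs_weil_space_smult
    by (intro weil.span_sum weil.span_scale) (simp only: weil.sel lessThan_iff)
  then show ?case
    using step by (simp add: iota_W.add iota_W.scale W_iota_grade_def weil.span_add weil.span_scale)
qed


section \<open>The map \<open>\<Upsilon>\<close>\<close>

text \<open>Multilinear expansion: the legs in \<open>S\<close> are replaced by forks, the others by legs of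
  grade 2.\<close>

definition upsilon_legs :: "half_edge set \<Rightarrow> half_edge list \<Rightarrow> (half_edge \<times> nat) list" where
  "upsilon_legs S hs =
     concat (map (\<lambda>h. if h \<in> S then [(EndL h, 1), (EndR h, 1)] else [(Old h, 2)]) hs)"

definition upsilon_ordered :: "ugraph \<Rightarrow> half_edge list \<Rightarrow> weil free" where
  "upsilon_ordered G hs = (\<Sum>S\<in>Pow (set hs).
     smult ((- 1 / 2) ^ card S) (gen (Weil (sprout S G) (upsilon_legs S hs) None)))"

definition upsilon_diagram :: "ugraph \<Rightarrow> weil free" where
  "upsilon_diagram G = upsilon_ordered G (SOME hs. distinct hs \<and> set hs = univalent G)"

lemma upsilon_legs_simps [simp]:
  "upsilon_legs S [] = []"
  "upsilon_legs S (h # hs) =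
     (if h \<in> S then [(EndL h, 1), (EndR h, 1)] else [(Old h, 2)]) @ upsilon_legs S hs"
  "upsilon_legs S (hs @ hs') = upsilon_legs S hs @ upsilon_legs S hs'"
  by (simp_all add: upsilon_legs_def)

lemma grade_upsilon_legs: "sum_list (map snd (upsilon_legs S hs)) = 2 * length hs"
  by (induction hs) auto

lemma fst_upsilon_legs:
  "fst ` set (upsilon_legs S hs) = Old ` (set hs - S) \<union> EndL ` (set hs \<inter> S) \<union> EndR ` (set hs \<inter> S)"
  by (induction hs) auto

lemma snd_upsilon_legs: "snd ` set (upsilon_legs S hs) \<subseteq> {1, 2}"
  by (induction hs) auto

lemma distinct_upsilon_legs: "distinct hs \<Longrightarrow> distinct (map fst (upsilon_legs S hs))"
  by (induction hs) (auto simp: fst_upsilon_legs)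

lemma weil_diagram_upsilon:
  assumes "unitrivalent G" "distinct hs" "set hs = univalent G" "S \<subseteq> univalent G"
  shows "weil_diagram (Weil (sprout S G) (upsilon_legs S hs) None)"
proof -
  have "univalent G \<inter> S = S"
    using assms(4) by blast
  then show ?thesis
    using assms snd_upsilon_legs[of S hs]
    by (simp add: weil_diagram_def unitrivalent_sprout distinct_upsilon_legs fst_upsilon_legs
        univalent_sprout)
qed

lemma abs_upsilon_ordered:
  "abs_weil_space (upsilon_ordered G hs) = (\<Sum>S\<in>Pow (set hs).
     scaleW ((- 1 / 2) ^ card S) (weil_class (Weil (sprout S G) (upsilon_legs S hs) None)))"
  by (simp add: upsilon_ordered_def abs_weil_space_simps)

lemma weil_class_upsilon_reorder:
  assumes "unitrivalent G" "distinct (us @ hs)" "set (us @ hs) = univalent G" "S \<subseteq> univalent G"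
    and "mset hs = mset hs'"
  shows "weil_class (Weil (sprout S G) (upsilon_legs S (us @ hs)) None)
    = weil_class (Weil (sprout S G) (upsilon_legs S (us @ hs')) None)"
  using assms
proof (induction hs arbitrary: us hs')
  case Nil
  then show ?case by simp
next
  case (Cons h hs)
  obtain as bs where hs': "hs' = as @ h # bs"
    using Cons.prems(5) by (metis list.set_intros(1) mset_eq_setD split_list)
  have m: "mset hs = mset (as @ bs)"
    using Cons.prems(5) by (simp add: hs')
  have s: "set hs = set as \<union> set bs" and d: "distinct hs = distinct (as @ bs)"
    using mset_eq_setD[OF m] mset_eq_imp_distinct_iff[OF m] by simp_all
  have "weil_class (Weil (sprout S G) (upsilon_legs S ((us @ [h]) @ hs)) None)
    = weil_class (Weil (sprout S G) (upsilon_legs S ((us @ [h]) @ as @ bs)) None)"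
    by (rule Cons.IH) (use Cons.prems m in auto)
  also have "\<dots> = weil_class (Weil (sprout S G)
      (upsilon_legs S us @ upsilon_legs S [h] @ upsilon_legs S as @ upsilon_legs S bs) None)"
    by (simp only: upsilon_legs_simps append_assoc)
  also have "\<dots> = weil_class (Weil (sprout S G)
      (upsilon_legs S us @ upsilon_legs S as @ upsilon_legs S [h] @ upsilon_legs S bs) None)"
  proof -
    have dist: "distinct (us @ [h] @ as @ bs)"
      using Cons.prems(2) s d by auto
    have set: "set (us @ [h] @ as @ bs) = univalent G"
      using Cons.prems(3) s by auto
    have "weil_diagram (Weil (sprout S G)
        (upsilon_legs S us @ upsilon_legs S [h] @ upsilon_legs S as @ upsilon_legs S bs) None)"
      using weil_diagram_upsilon[OF Cons.prems(1) dist set Cons.prems(4)]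
      by (simp only: upsilon_legs_simps append_assoc)
    from weil_class_swap_blocks[OF this] show ?thesis
      by (simp only: grade_upsilon_legs) (simp add: power_mult)
  qed
  also have "\<dots> = weil_class (Weil (sprout S G) (upsilon_legs S (us @ hs')) None)"
    by (simp add: hs')
  finally show ?case
    by simp
qed

lemma upsilon_ordered_indep:
  assumes "unitrivalent G" "distinct hs" "set hs = univalent G" "distinct hs'" "set hs' = univalent G"
  shows "abs_weil_space (upsilon_ordered G hs) = abs_weil_space (upsilon_ordered G hs')"
proof -
  have "mset hs = mset hs'"
    using assms by (simp add: set_eq_iff_mset_eq_distinct[symmetric])
  then show ?thesis
    unfolding abs_upsilon_ordered assms(3,5)
    using weil_class_upsilon_reorder[OF assms(1), of "[]" hs _ hs'] assms
    by (intro sum.cong) auto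
qed

lemma exists_ordering:
  assumes "unitrivalent G"
  shows "\<exists>hs. distinct hs \<and> set hs = univalent G"
proof -
  have "finite (univalent G)"
    using assms by (simp add: unitrivalent_def univalent_def)
  from finite_distinct_list[OF this] show ?thesis
    by blast
qed

lemma upsilon_diagram_ordered:
  assumes "unitrivalent G" "distinct hs" "set hs = univalent G"
  shows "abs_weil_space (upsilon_diagram G) = abs_weil_space (upsilon_ordered G hs)"
  unfolding upsilon_diagram_def
  using someI_ex[OF exists_ordering[OF assms(1)]] assms
  by (intro upsilon_ordered_indep) auto

lemma upsilon_legs_map:
  assumes "inj_on f A" "set hs \<subseteq> A" "S \<subseteq> A"
  shows "upsilon_legs (f ` S) (map f hs) = map (apfst (lift_iso f)) (upsilon_legs S hs)"
  using assms(2)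
proof (induction hs)
  case (Cons h hs)
  then have "f h \<in> f ` S \<longleftrightarrow> h \<in> S"
    using assms by (auto simp: inj_on_def)
  with Cons show ?case by auto
qed simp

lemma upsilon_relations:
  assumes "r \<in> jacobi_relations"
  shows "lin_ext upsilon_diagram r \<in> free_span weil_relations"
proof -
  consider (iso) G G' f where "r = gen G - gen G'" "unitrivalent G" "unitrivalent G'" "graph_iso f G G'"
    | (loc) Gs where "r = (\<Sum>G\<leftarrow>Gs. gen G)" "local_relation Gs" "\<And>G. G \<in> set Gs \<Longrightarrow> unitrivalent G"
    using assms unfolding jacobi_relations_def by blast
  then have "abs_weil_space (lin_ext upsilon_diagram r) = 0"
  proof cases
    case iso
    obtain hs where hs: "distinct hs" "set hs = univalent G"
      using exists_ordering[OF iso(2)] by blast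
    have f: "inj_on f (half_edges G)" "f ` half_edges G = half_edges G'"
      "\<And>h. h \<in> half_edges G \<Longrightarrow> rot G h \<in> half_edges G \<and> f (rot G h) = rot G' (f h)"
      using iso(2,4) by (auto simp: graph_iso_def bij_betw_def unitrivalent_def)
    have sub: "univalent G \<subseteq> half_edges G"
      by (auto simp: univalent_def)
    have univ: "f ` univalent G = univalent G'"
    proof -
      have "h \<in> univalent G \<longleftrightarrow> f h \<in> univalent G'" if h: "h \<in> half_edges G" for h
      proof -
        have "rot G' (f h) = f h \<longleftrightarrow> rot G h = h"
          using f(3)[OF h] inj_on_eq_iff[OF f(1), of "rot G h" h] h by simp
        then show ?thesis
          using f(2) h by (auto simp: univalent_def)
      qed
      moreover have "univalent G' \<subseteq> f ` half_edges G"
        using f(2) by (auto simp: univalent_def)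
      ultimately show ?thesis
        using sub by blast
    qed
    have inj: "inj_on f (univalent G)"
      using f(1) sub by (rule inj_on_subset)
    have hs': "distinct (map f hs)" "set (map f hs) = univalent G'"
      using hs inj univ by (auto simp: distinct_map)
    have "weil_class (Weil (sprout (f ` S) G') (upsilon_legs (f ` S) (map f hs)) None)
        = weil_class (Weil (sprout S G) (upsilon_legs S hs) None)" if S: "S \<subseteq> univalent G" for S
    proof (rule weil_class_iso[symmetric])
      show "weil_diagram (Weil (sprout S G) (upsilon_legs S hs) None)"
        by (rule weil_diagram_upsilon[OF iso(2) hs S])
      show "weil_diagram (Weil (sprout (f ` S) G') (upsilon_legs (f ` S) (map f hs)) None)"
        by (rule weil_diagram_upsilon[OF iso(3) hs']) (use S univ in blast)
      show "weil_iso (lift_iso f) (Weil (sprout S G) (upsilon_legs S hs) None)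
          (Weil (sprout (f ` S) G') (upsilon_legs (f ` S) (map f hs)) None)"
        using graph_iso_sprout[OF iso(4) S] upsilon_legs_map[OF inj _ S, of hs] hs
        by (simp add: weil_iso_def)
    qed
    moreover have "card (f ` S) = card S" if "S \<subseteq> univalent G" for S
      using inj that by (meson card_image inj_on_subset)
    moreover have "bij_betw (image f) (Pow (univalent G)) (Pow (univalent G'))"
      using inj univ by (intro bij_betw_Pow) (simp add: bij_betw_def)
    ultimately have "abs_weil_space (upsilon_ordered G' (map f hs)) = abs_weil_space (upsilon_ordered G hs)"
      unfolding abs_upsilon_ordered hs hs'(2)
      by (subst sum.reindex_bij_betw[symmetric, of "image f" "Pow (univalent G)"])
        (auto intro!: sum.cong)
    then show ?thesis
      unfolding iso(1)
      by (simp add: lin_ext.diff abs_weil_space_diff upsilon_diagram_ordered[OF iso(2) hs]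
          upsilon_diagram_ordered[OF iso(3) hs'])
  next
    case loc
    show ?thesis
    proof (cases "Gs = []")
      case True
      then show ?thesis by (simp add: loc(1) lin_ext.zero abs_weil_space_0)
    next
      case False
      then obtain G0 where G0: "G0 \<in> set Gs"
        by (meson list.set_sel(1))
      obtain hs where hs: "distinct hs" "set hs = univalent G0"
        using exists_ordering[OF loc(3)[OF G0]] by blast
      have univ: "univalent G = univalent G0" if "G \<in> set Gs" for G
        using local_relation_univalent[OF loc(2,3) that G0] by simp
      have ups: "abs_weil_space (upsilon_diagram G) = abs_weil_space (upsilon_ordered G hs)"
        if "G \<in> set Gs" for G
        using upsilon_diagram_ordered[OF loc(3)[OF that]] hs univ[OF that] by auto
      have "(\<Sum>G\<leftarrow>Gs. weil_class (Weil (sprout S G) (upsilon_legs S hs) None)) = 0"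
        if S: "S \<subseteq> univalent G0" for S
      proof -
        have "local_relation (map (sprout S) Gs)"
          by (rule local_relation_sprout[OF loc(2,3)]) (use S univ in auto)
        then have "(\<Sum>G\<leftarrow>map (sprout S) Gs. weil_class (Weil G (upsilon_legs S hs) None)) = 0"
        proof (rule weil_class_local)
          fix G
          assume "G \<in> set (map (sprout S) Gs)"
          then obtain G1 where G1: "G1 \<in> set Gs" "G = sprout S G1"
            by auto
          show "weil_diagram (Weil G (upsilon_legs S hs) None)"
            unfolding G1(2) by (rule weil_diagram_upsilon[OF loc(3)[OF G1(1)]])
              (use S hs univ[OF G1(1)] in auto)
        qed
        then show ?thesis by (simp add: o_def)
      qed
      note 1 = this
      have "abs_weil_space (lin_ext upsilon_diagram r) = (\<Sum>G\<leftarrow>Gs. abs_weil_space (upsilon_ordered G hs))"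
        unfolding loc(1) using ups
        by (simp add: lin_ext_sum_list abs_weil_space_sum_list o_def cong: map_cong)
      also have "\<dots> = (\<Sum>S\<in>Pow (set hs). scaleW ((- 1 / 2) ^ card S)
          (\<Sum>G\<leftarrow>Gs. weil_class (Weil (sprout S G) (upsilon_legs S hs) None)))"
        unfolding abs_upsilon_ordered
        by (induction Gs) (simp_all add: sum.distrib weil.scale_right_distrib)
      also have "\<dots> = 0"
        using 1 hs by (intro sum.neutral) auto
      finally show ?thesis .
    qed
  qed
  then show ?thesis
    by (simp only: abs_weil_space_eq_0)
qed

lift_definition Upsilon :: "jacobi_space \<Rightarrow> weil_space" is "lin_ext upsilon_diagram"
proof -
  fix p q
  assume "jacobi_equiv p q"
  then have "p - q \<in> free_span jacobi_relations"
    by (simp add: jacobi_equiv_def)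
  then have "lin_ext upsilon_diagram (p - q) \<in> free_span weil_relations"
    by (rule lin_ext_span[rotated]) (rule upsilon_relations)
  then show "weil_equiv (lin_ext upsilon_diagram p) (lin_ext upsilon_diagram q)"
    by (simp add: weil_equiv_def lin_ext.diff)
qed

lemma linear_Upsilon: "Vector_Spaces.linear scaleJ scaleW Upsilon"
  by unfold_locales
    (transfer; simp add: lin_ext_add lin_ext_smult weil_equiv_def free.span_zero)+

interpretation Upsilon: Vector_Spaces.linear scaleJ scaleW Upsilon
  by (rule linear_Upsilon)

text \<open>The map does not depend on the choice of the ordering of the legs.\<close>

lemma Upsilon_class:
  assumes "unitrivalent G" "distinct hs" "set hs = univalent G"
  shows "Upsilon (jacobi_class G) = (\<Sum>S\<in>Pow (univalent G).
     scaleW ((- 1 / 2) ^ card S) (weil_class (Weil (sprout S G) (upsilon_legs S hs) None)))"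
  using upsilon_diagram_ordered[OF assms]
  by (simp add: jacobi_class_def Upsilon.abs_eq abs_upsilon_ordered assms(3))

lemma Upsilon_grade: "x \<in> B_grade i \<Longrightarrow> Upsilon x \<in> W_grade i"
  unfolding B_grade_def
proof (induction rule: jacobi.span_induct_alt)
  case base
  then show ?case by (simp add: Upsilon.zero W_grade_def weil.span_zero)
next
  case (step c x y)
  then obtain G where x: "x = jacobi_class G" and G: "unitrivalent G"
    and i: "2 * int (card (univalent G)) = i"
    by auto
  obtain hs where hs: "distinct hs" "set hs = univalent G"
    using exists_ordering[OF G] by blast
  have "weil_class (Weil (sprout S G) (upsilon_legs S hs) None) \<in> W_grade i"
    if "S \<subseteq> univalent G" for S
    unfolding W_grade_def
  proof (rule weil.span_base, intro CollectI exI conjI)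
    show "weil_diagram (Weil (sprout S G) (upsilon_legs S hs) None)"
      by (rule weil_diagram_upsilon[OF G hs that])
    show "leg_grade (Weil (sprout S G) (upsilon_legs S hs) None) = i"
      using i hs by (simp add: leg_grade_def grade_upsilon_legs flip: distinct_card)
  qed (rule refl, simp)
  then have "Upsilon x \<in> W_grade i"
    unfolding x Upsilon_class[OF G hs] W_grade_def
    by (intro weil.span_sum weil.span_scale) auto
  then show ?case
    using step by (simp add: Upsilon.add Upsilon.scale W_grade_def weil.span_add weil.span_scale)
qed


section \<open>Basic cohomology\<close>

definition W_basic :: "int \<Rightarrow> weil_space set" where
  "W_basic i = {w \<in> W_grade i. iota_W w = 0}"

definition basic_cocycles :: "int \<Rightarrow> weil_space set" where
  "basic_cocycles i = {w \<in> W_basic i. d_W w = 0}"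

definition basic_coboundaries :: "int \<Rightarrow> weil_space set" where
  "basic_coboundaries i = d_W ` W_basic (i - 1)"

definition cohomologous :: "int \<Rightarrow> (weil_space \<times> weil_space) set" where
  "cohomologous i = {(v, w). v \<in> basic_cocycles i \<and> w \<in> basic_cocycles i \<and>
     v - w \<in> basic_coboundaries i}"

definition H_basic :: "int \<Rightarrow> weil_space set set" where
  "H_basic i = basic_cocycles i // cohomologous i"

definition H_class :: "int \<Rightarrow> weil_space \<Rightarrow> weil_space set" where
  "H_class i w = cohomologous i `` {w}"

definition H_add :: "int \<Rightarrow> weil_space set \<Rightarrow> weil_space set \<Rightarrow> weil_space set" where
  "H_add i V W = (\<Union>v\<in>V. \<Union>w\<in>W. H_class i (v + w))"

definition H_scale :: "int \<Rightarrow> rat \<Rightarrow> weil_space set \<Rightarrow> weil_space set" where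
  "H_scale i c V = (\<Union>v\<in>V. H_class i (scaleW c v))"

lemma subspace_W_basic: "weil.subspace (W_basic i)"
  unfolding W_basic_def W_grade_def weil.subspace_def
  by (auto simp: weil.span_zero weil.span_add weil.span_scale iota_W.zero iota_W.add iota_W.scale)

lemma subspace_basic_cocycles: "weil.subspace (basic_cocycles i)"
  using subspace_W_basic[of i] unfolding basic_cocycles_def weil.subspace_def
  by (auto simp: d_W.zero d_W.add d_W.scale)

lemma subspace_basic_coboundaries: "weil.subspace (basic_coboundaries i)"
  unfolding basic_coboundaries_def by (rule d_W.subspace_image[OF subspace_W_basic])

lemma equiv_cohomologous: "equiv (basic_cocycles i) (cohomologous i)"
proof (rule equivI)
  show "cohomologous i \<subseteq> basic_cocycles i \<times> basic_cocycles i"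
    by (auto simp: cohomologous_def)
  show "refl_on (basic_cocycles i) (cohomologous i)"
    using weil.subspace_0[OF subspace_basic_coboundaries]
    by (auto simp: refl_on_def cohomologous_def)
  show "sym (cohomologous i)"
    using weil.subspace_neg[OF subspace_basic_coboundaries]
    by (force simp: sym_def cohomologous_def)
  show "trans (cohomologous i)"
    using weil.subspace_add[OF subspace_basic_coboundaries]
    by (force simp: trans_def cohomologous_def)
qed

lemma H_add_class:
  assumes "v \<in> basic_cocycles i" "w \<in> basic_cocycles i"
  shows "H_add i (H_class i v) (H_class i w) = H_class i (v + w)"
proof -
  have "H_class i (v' + w') = H_class i (v + w)" if "v' \<in> H_class i v" "w' \<in> H_class i w" for v' w'
  proof -
    have that: "(v, v') \<in> cohomologous i" "(w, w') \<in> cohomologous i"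
      using that by (simp_all add: H_class_def)
    have "(v - v') + (w - w') \<in> basic_coboundaries i"
      using that by (intro weil.subspace_add[OF subspace_basic_coboundaries])
        (auto simp: cohomologous_def)
    moreover have "(v - v') + (w - w') = v + w - (v' + w')"
      by simp
    ultimately have "(v + w, v' + w') \<in> cohomologous i"
      using that weil.subspace_add[OF subspace_basic_cocycles]
      by (auto simp: cohomologous_def)
    then show ?thesis
      unfolding H_class_def using equiv_class_eq[OF equiv_cohomologous] by blast
  qed
  moreover have "v \<in> H_class i v" "w \<in> H_class i w"
    using assms equiv_class_self[OF equiv_cohomologous] by (auto simp: H_class_def)
  ultimately show ?thesis
    unfolding H_add_def by blast
qed

lemma H_scale_class:
  assumes "v \<in> basic_cocycles i"
  shows "H_scale i c (H_class i v) = H_class i (scaleW c v)"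
proof -
  have "H_class i (scaleW c v') = H_class i (scaleW c v)" if "v' \<in> H_class i v" for v'
  proof -
    have that: "(v, v') \<in> cohomologous i"
      using that by (simp add: H_class_def)
    have "scaleW c v - scaleW c v' = scaleW c (v - v')"
      by (simp add: weil.scale_right_diff_distrib)
    then have "(scaleW c v, scaleW c v') \<in> cohomologous i"
      using that weil.subspace_scale[OF subspace_basic_coboundaries]
        weil.subspace_scale[OF subspace_basic_cocycles]
      by (auto simp: cohomologous_def)
    then show ?thesis
      unfolding H_class_def using equiv_class_eq[OF equiv_cohomologous] by blast
  qed
  moreover have "v \<in> H_class i v"
    using assms equiv_class_self[OF equiv_cohomologous] by (auto simp: H_class_def)
  ultimately show ?thesis
    unfolding H_scale_def by blast
qed

text \<open>The \<open>\<iota>\<close>-complex of symmetric Jacobi diagrams has zero differential and zero \<open>\<iota>\<close>, so that its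
  basic cohomology in degree \<open>i\<close> is \<open>B_grade i\<close> itself.\<close>

definition H_Upsilon :: "int \<Rightarrow> jacobi_space \<Rightarrow> weil_space set" where
  "H_Upsilon i x = H_class i (Upsilon x)"

end

theory Submission
  imports Defs
begin

text \<open>
  Turning the special vertex into a first leg of grade 1 and composing with \<open>\<iota>\<close> gives the
  derivation that fixes a grade 1 leg \<open>\<theta>\<close> and sends a grade 2 leg to a fork, so that it kills the curvature
  \<open>F\<close>, a grade 2 leg minus half a fork. In terms of \<open>\<theta>\<close> and \<open>F\<close> it multiplies a diagram by its number
  of legs \<open>\<theta>\<close> (in terms of the given legs, it is triangular for the filtration by the number of grade 2
  legs, with these eigenvalues), whence the kernel of \<open>\<iota>\<close> is spanned by the diagrams with legs \<open>F\<close> only, that is, by the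
  image of \<open>\<Upsilon>\<close>. In particular it vanishes in odd degree. By Cartan's formula \<open>\<iota> d + d \<iota>\<close> attaches the
  special vertex to all the legs in turn, which gives 0 by AS and IHX; hence \<open>d\<close> maps the kernel of \<open>\<iota>\<close>,
  concentrated in even degree, into itself, and vanishes on it. So the basic cohomology is the image
  of \<open>\<Upsilon>\<close>, on which \<open>\<Upsilon>\<close> is inverted by forgetting the diagrams that have a leg of grade 1.
\<close>

section \<open>Sums over the splittings of a list\<close>

text \<open>Each term of a leg operator depends on the legs before the chosen one, which give the
  sign, and on those after it. Handing both lists to the summand replaces index arithmetic by
  structural induction.\<close>

fun split_sum :: "('a list \<Rightarrow> 'a \<Rightarrow> 'a list \<Rightarrow> 'b::comm_monoid_add) \<Rightarrow> 'a list \<Rightarrow> 'b" where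
  "split_sum f [] = 0"
| "split_sum f (x # xs) = f [] x xs + split_sum (\<lambda>us. f (x # us)) xs"

lemma split_sum_nth:
  "split_sum f xs = (\<Sum>k<length xs. f (take k xs) (xs ! k) (drop (Suc k) xs))"
  by (induction xs arbitrary: f) (simp_all add: sum.lessThan_Suc_shift del: sum.lessThan_Suc)

lemma split_sum_append:
  "split_sum f (xs @ ys)
    = split_sum (\<lambda>us x vs. f us x (vs @ ys)) xs + split_sum (\<lambda>us. f (xs @ us)) ys"
  by (induction xs arbitrary: f) (simp_all add: add.assoc)

lemma split_sum_cong:
  assumes "xs = ys" "\<And>us x vs. ys = us @ x # vs \<Longrightarrow> f us x vs = g us x vs"
  shows "split_sum f xs = split_sum g ys"
  unfolding assms(1) using assms(2)
proof (induction ys arbitrary: f g)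
  case (Cons y ys)
  have "split_sum (\<lambda>us. f (y # us)) ys = split_sum (\<lambda>us. g (y # us)) ys"
    by (rule Cons.IH) (use Cons.prems in auto)
  then show ?case
    using Cons.prems[of "[]"] by simp
qed simp

lemma split_sum_map:
  "split_sum f (map g xs) = split_sum (\<lambda>us x vs. f (map g us) (g x) (map g vs)) xs"
  by (induction xs arbitrary: f) simp_all

lemma split_sum_add:
  "split_sum (\<lambda>us x vs. f us x vs + g us x vs) xs = split_sum f xs + split_sum g xs"
  by (induction xs arbitrary: f g) (simp_all add: add_ac)

lemma split_sum_zero [simp]: "split_sum (\<lambda>us x vs. 0) xs = 0"
  by (induction xs) simp_all

lemma split_sum_minus:
  fixes f :: "'a list \<Rightarrow> 'a \<Rightarrow> 'a list \<Rightarrow> 'b::ab_group_add"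
  shows "split_sum (\<lambda>us x vs. - f us x vs) xs = - split_sum f xs"
  by (induction xs arbitrary: f) simp_all

lemma split_sum_hom:
  assumes "\<And>x y. h (x + y) = h x + h y" "h 0 = 0"
  shows "h (split_sum f xs) = split_sum (\<lambda>us x vs. h (f us x vs)) xs"
  by (induction xs arbitrary: f) (simp_all add: assms)

lemma split_sum_scaleW: "scaleW c (split_sum f xs) = split_sum (\<lambda>us x vs. scaleW c (f us x vs)) xs"
  by (rule split_sum_hom) (simp_all add: weil.scale_right_distrib)

text \<open>Both sides run over the pairs of positions with \<open>y\<close> before
  \<open>x\<close>; only the order of the two choices differs. This is how the mixed terms in
  Cartan's formula are matched.\<close>

lemma split_sum_swap:
  "split_sum (\<lambda>us x vs. split_sum (\<lambda>as y bs. f as y bs x vs) us) xs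
    = split_sum (\<lambda>us y vs. split_sum (\<lambda>as x bs. f us y as x bs) vs) xs"
  by (induction xs arbitrary: f) (simp_all add: split_sum_add)

lemma split_sum_const: "split_sum (\<lambda>us x vs. f x) xs = (\<Sum>x\<leftarrow>xs. f x)"
  by (induction xs) simp_all

lemma sum_split_sum:
  "(\<Sum>i\<in>A. split_sum (f i) xs) = split_sum (\<lambda>us x vs. \<Sum>i\<in>A. f i us x vs) xs"
proof (induction xs arbitrary: f)
  case (Cons x xs)
  then show ?case
    by (simp only: split_sum.simps sum.distrib)
qed simp


section \<open>Cartan's formula\<close>

abbreviation parity :: "('a \<times> nat) list \<Rightarrow> rat" where
  "parity ls \<equiv> (-1) ^ sum_list (map snd ls)"

abbreviation old_legs :: "(half_edge \<times> nat) list \<Rightarrow> (half_edge \<times> nat) list" where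
  "old_legs \<equiv> map (apfst Old)"

text \<open>For \<open>g = 1\<close> this is the value of \<open>\<iota>\<close> on a grade 2 leg.
  The grade is left free because \<open>d\<close> of that value, and the right-hand side of Cartan's
  formula, need the other grade as well.\<close>

definition attach :: "ugraph \<Rightarrow> (half_edge \<times> nat) list \<Rightarrow> half_edge \<Rightarrow> nat \<Rightarrow>
    (half_edge \<times> nat) list \<Rightarrow> weil_space" where
  "attach G us h g vs = weil_class (Weil (sprout {h} G)
     (old_legs us @ (EndR h, g) # old_legs vs) (Some (EndL h)))"

text \<open>A single term of \<open>\<iota>\<close>, without its sign.\<close>

definition contract :: "ugraph \<Rightarrow> (half_edge \<times> nat) list \<Rightarrow> half_edge \<times> nat \<Rightarrow>
    (half_edge \<times> nat) list \<Rightarrow> weil_space" where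
  "contract G us x vs = (if snd x = 1 then weil_class (Weil G (us @ vs) (Some (fst x)))
     else attach G us (fst x) 1 vs)"

lemma d_W_Weil:
  "d_W (weil_class (Weil G ls s)) = split_sum (\<lambda>us x vs. if snd x = 1
     then scaleW (parity us) (weil_class (Weil G (us @ (fst x, 2) # vs) s)) else 0) ls"
  unfolding d_W_class leg_operator_def split_sum_nth
  by (auto simp: abs_weil_space_simps upd_conv_take_nth_drop intro!: sum.cong)

lemma iota_W_Weil:
  "iota_W (weil_class (Weil G ls None))
    = split_sum (\<lambda>us x vs. scaleW (parity us) (contract G us x vs)) ls"
proof -
  have "abs_weil_space (iota_rule k (Weil G ls None))
      = contract G (take k ls) (ls ! k) (drop (Suc k) ls)" if "k < length ls" for k
    using iota_rule_nth[of "take k ls" G "fst (ls ! k)" "snd (ls ! k)" "drop (Suc k) ls"] that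
    by (simp add: contract_def attach_def abs_weil_space_gen id_take_nth_drop[symmetric]
        del: iota_rule.simps)
  moreover have "(-1::rat) powi (- int n) = (-1) ^ n" for n
    using power_minus_one_cases[of n] by (auto simp: power_int_minus)
  ultimately show ?thesis
    unfolding iota_W_class leg_operator_def split_sum_nth
    by (auto simp: abs_weil_space_simps simp del: iota_rule.simps intro!: sum.cong)
qed

text \<open>The summands come from the legs before \<open>y\<close>, the leg left in place of
  \<open>y\<close>, and the legs after it. Contraction lowers the grade at \<open>y\<close> by one,
  whence the minus sign in the last summand; a grade 1 leg disappears and leaves no middle
  term.\<close>

lemma d_W_contract:
  assumes "snd y \<in> {1, 2}"
  shows "d_W (contract G us y vs)
    = split_sum (\<lambda>as x bs. if snd x = 1
        then scaleW (parity as) (contract G (as @ (fst x, 2) # bs) y vs) else 0) us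
    + (if snd y = 1 then 0 else scaleW (parity us) (attach G us (fst y) 2 vs))
    + split_sum (\<lambda>as x bs. if snd x = 1
        then scaleW (- parity (us @ y # as)) (contract G us y (as @ (fst x, 2) # bs)) else 0) vs"
proof (cases "snd y = 1")
  case True
  then show ?thesis
    by (auto simp: contract_def d_W_Weil split_sum_append intro!: arg_cong2[where f = plus] split_sum_cong)
next
  case False
  then have "snd y = 2"
    using assms by simp
  then show ?thesis
    by (auto simp: contract_def attach_def d_W_Weil split_sum_append split_sum_map o_def add.assoc
        intro!: arg_cong2[where f = plus] split_sum_cong)
qed

text \<open>On different legs \<open>d\<close> and \<open>\<iota>\<close> anticommute, so only the
  terms in which both act at the same leg survive.\<close>

lemma Cartan:
  assumes "snd ` set ls \<subseteq> {1, 2}"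
  shows "iota_W (d_W (weil_class (Weil G ls None))) + d_W (iota_W (weil_class (Weil G ls None)))
    = split_sum (\<lambda>us x vs. attach G us (fst x) (snd x) vs) ls"
proof -
  \<comment> \<open>Here \<open>d\<close> acts at \<open>x\<close> and \<open>\<iota>\<close> at
    \<open>y\<close>: \<open>f\<close> has \<open>y\<close> before \<open>x\<close>, and
    \<open>g\<close> has \<open>x\<close> before \<open>y\<close>. The diagonal terms are
    \<open>r\<close> (first \<open>d\<close>, at a grade 1 leg) and \<open>t\<close> (first
    \<open>\<iota>\<close>, at a grade 2 leg).\<close>
  define f where "f = (\<lambda>as y bs x vs. if snd x = (1::nat)
    then scaleW (parity as * parity (as @ y # bs)) (contract G as y (bs @ (fst x, 2) # vs)) else 0)"
  define g where "g = (\<lambda>as x bs y vs. if snd x = (1::nat)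
    then scaleW (parity bs) (contract G (as @ (fst x, 2) # bs) y vs) else 0)"
  define r where "r = (\<lambda>us x vs. if snd x = (1::nat) then attach G us (fst x) 1 vs else 0)"
  define t where "t = (\<lambda>us x vs. if snd x = (1::nat) then 0 else attach G us (fst x) 2 vs)"
  have sq: "parity us * parity us = 1" "parity us * (parity us * c) = c" for us :: "(half_edge \<times> nat) list" and c
    using minus_one_power_square by (simp_all flip: mult.assoc)
  have scale_if: "scaleW c (if P then x else 0) = (if P then scaleW c x else 0)" for c P x
    by simp
  have 1: "iota_W (d_W (weil_class (Weil G ls None)))
      = split_sum (\<lambda>us x vs. split_sum (\<lambda>as y bs. f as y bs x vs) us + r us x vs
          + split_sum (\<lambda>as y bs. g us x as y bs) vs) ls"
  proof -
    have "iota_W (scaleW (parity us) (weil_class (Weil G (us @ (fst x, 2) # vs) None)))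
        = split_sum (\<lambda>as y bs. f as y bs x vs) us + r us x vs
          + split_sum (\<lambda>as y bs. g us x as y bs) vs" if "snd x = 1" for us x vs
      using that
      by (auto simp: iota_W.scale iota_W_Weil split_sum_append weil.scale_right_distrib
          split_sum_scaleW sq power_add add.assoc f_def g_def r_def mult_ac contract_def
          intro!: arg_cong2[where f = plus] split_sum_cong)
    moreover have "split_sum (\<lambda>as y bs. f as y bs x vs) us + r us x vs
          + split_sum (\<lambda>as y bs. g us x as y bs) vs = 0" if "snd x \<noteq> 1" for us x vs
      using that by (simp add: f_def g_def r_def)
    ultimately show ?thesis
      unfolding d_W_Weil split_sum_hom[where h = iota_W, OF iota_W.add iota_W.zero]
      by (intro split_sum_cong refl) (simp add: iota_W.zero del: One_nat_def)
  qed
  have 2: "d_W (iota_W (weil_class (Weil G ls None)))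
      = split_sum (\<lambda>us y vs. split_sum (\<lambda>as x bs. - g as x bs y vs) us + t us y vs
          + split_sum (\<lambda>as x bs. - f us y as x bs) vs) ls"
    unfolding iota_W_Weil split_sum_hom[where h = d_W, OF d_W.add d_W.zero]
  proof (rule split_sum_cong[OF refl])
    fix us y vs
    assume "ls = us @ y # vs"
    then have y: "snd y \<in> {1, 2}"
      using assms by auto
    show "d_W (scaleW (parity us) (contract G us y vs))
      = split_sum (\<lambda>as x bs. - g as x bs y vs) us + t us y vs + split_sum (\<lambda>as x bs. - f us y as x bs) vs"
      unfolding d_W.scale d_W_contract[OF y] weil.scale_right_distrib split_sum_scaleW scale_if
      by (intro arg_cong2[where f = plus] split_sum_cong refl)
        (auto simp: f_def g_def t_def power_add mult_ac sq)
  qed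
  have 3: "split_sum r ls + split_sum t ls = split_sum (\<lambda>us x vs. attach G us (fst x) (snd x) vs) ls"
    unfolding split_sum_add[symmetric]
    by (rule split_sum_cong) (use assms in \<open>auto simp: r_def t_def\<close>)
  show ?thesis
    unfolding 1 2 split_sum_add split_sum_swap[symmetric] split_sum_minus 3[symmetric] by simp
qed


section \<open>Invariance\<close>

lemma unitrivalent_eq_iff:
  assumes "unitrivalent G" "x \<in> half_edges G" "y \<in> half_edges G"
  shows "rot G x = rot G y \<longleftrightarrow> x = y" "opp G x = opp G y \<longleftrightarrow> x = y"
  using assms unfolding unitrivalent_def by metis+

lemma unitrivalentD:
  assumes "unitrivalent G" "x \<in> half_edges G"
  shows "rot G x \<in> half_edges G" "rot G (rot G (rot G x)) = x"
    "opp G x \<in> half_edges G" "opp G (opp G x) = x" "opp G x \<noteq> x"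
  using assms unfolding unitrivalent_def by auto

lemma unitrivalent_reverse_at:
  assumes "unitrivalent G" "h \<in> half_edges G"
  shows "unitrivalent (reverse_at h G)"
proof -
  have "rot G (rot G k) = k \<longleftrightarrow> rot G k = k" if "k \<in> half_edges G" for k
    using that assms(1) by (metis unitrivalentD(2))
  then have "rot (reverse_at h G) x \<in> half_edges G \<and>
      rot (reverse_at h G) (rot (reverse_at h G) (rot (reverse_at h G) x)) = x"
    if "x \<in> half_edges G" for x
    using assms that by (auto simp: reverse_at_def unitrivalentD unitrivalent_eq_iff)
  then show ?thesis
    using assms(1) by (simp add: unitrivalent_def reverse_at_def)
qed

lemma weil_class_reverse_at:
  assumes "weil_diagram (Weil G ls s)" "h \<in> half_edges G" "rot G h \<noteq> h"
  shows "weil_diagram (Weil (reverse_at h G) ls s)"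
    and "weil_class (Weil (reverse_at h G) ls s) = - weil_class (Weil G ls s)"
proof -
  have G: "unitrivalent G"
    using assms(1) by (simp add: weil_diagram_def)
  have rel: "local_relation [G, reverse_at h G]"
    using assms(2,3) by (rule AS)
  then have "univalent (reverse_at h G) = univalent G"
    by (rule local_relation_univalent) (use G assms(2) in \<open>auto simp: unitrivalent_reverse_at\<close>)
  then show valid: "weil_diagram (Weil (reverse_at h G) ls s)"
    using assms unitrivalent_reverse_at[OF G assms(2)] by (simp add: weil_diagram_def)
  show "weil_class (Weil (reverse_at h G) ls s) = - weil_class (Weil G ls s)"
    using weil_class_local[OF rel, of ls s] assms(1) valid
    by (auto simp: add_eq_0_iff)
qed

text \<open>Validity is assumed for the first diagram only and passes to the other two: the six
  half-edges make up two whole vertices, so \<open>rot\<close> also preserves their complement,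
  where nothing changes.\<close>

lemma weil_class_IHX:
  assumes "weil_diagram (Weil G ls s)"
    and "{u, v, a, b, c, e} \<subseteq> half_edges G" "distinct [u, v, a, b, c, e]" "opp G u = v"
    and "rot G a = b" "rot G b = u" "rot G u = a" "rot G v = c" "rot G c = e" "rot G e = v"
  shows "weil_diagram (Weil (tree_T G u v b c a e) ls s)"
    and "weil_diagram (Weil (tree_T G u v c a b e) ls s)"
    and "weil_class (Weil G ls s) + weil_class (Weil (tree_T G u v b c a e) ls s)
      + weil_class (Weil (tree_T G u v c a b e) ls s) = 0"
proof -
  have G: "unitrivalent G"
    using assms(1) by (simp add: weil_diagram_def)
  have self: "tree_T G u v a b c e = G"
    by (rule tree_T_self) (use assms in auto)
  have rel: "local_relation [G, tree_T G u v b c a e, tree_T G u v c a b e]"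
    using IHX[OF assms(2-)] by (simp only: self)
  define E where "E = {u, v, a, b, c, e}"
  have E: "rot G ` E = E" "E \<subseteq> half_edges G"
    using assms(2,5-) by (auto simp: E_def)
  have outside: "rot G x \<notin> E" if "x \<in> half_edges G" "x \<notin> E" for x
  proof
    assume "rot G x \<in> E"
    then obtain y where "y \<in> E" "rot G x = rot G y"
      using E(1) by (metis imageE)
    then show False
      using unitrivalent_eq_iff(1)[OF G that(1)] that E(2) by blast
  qed
  have tree: "unitrivalent (tree_T G u v a' b' c' e)"
    if eq: "{u, v, a', b', c', e} = E" and dist: "distinct [u, v, a', b', c', e]" for a' b' c'
  proof -
    have mem: "{u, v, a', b', c', e} \<subseteq> half_edges G"
      using eq E(2) by simp
    let ?r = "rot (tree_T G u v a' b' c' e)"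
    have cyc: "?r a' = b'" "?r b' = u" "?r u = a'" "?r v = c'" "?r c' = e" "?r e = v"
      using dist by (auto simp: tree_T_def)
    have "?r x \<in> half_edges G \<and> ?r (?r (?r x)) = x" if x: "x \<in> half_edges G" for x
    proof (cases "x \<in> E")
      case True
      then have "x \<in> {u, v, a', b', c', e}"
        using eq by simp
      then show ?thesis
        using mem cyc by auto
    next
      case False
      have r: "?r y = rot G y" if "y \<notin> E" for y
        using that unfolding eq[symmetric] by (simp add: tree_T_def)
      show ?thesis
        using False x outside unitrivalentD(1,2)[OF G] by (simp add: r)
    qed
    then show ?thesis
      using G by (simp add: unitrivalent_def tree_T_def)
  qed
  have uni: "unitrivalent (tree_T G u v b c a e)" "unitrivalent (tree_T G u v c a b e)"
    by (rule tree; use assms(3) in \<open>auto simp: E_def\<close>)+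
  then have "univalent (tree_T G u v b c a e) = univalent G" "univalent (tree_T G u v c a b e) = univalent G"
    by (intro local_relation_univalent[OF rel]; use G in auto)+
  then show valid: "weil_diagram (Weil (tree_T G u v b c a e) ls s)"
    "weil_diagram (Weil (tree_T G u v c a b e) ls s)"
    using assms(1) uni by (simp_all add: weil_diagram_def)
  show "weil_class (Weil G ls s) + weil_class (Weil (tree_T G u v b c a e) ls s)
      + weil_class (Weil (tree_T G u v c a b e) ls s) = 0"
    using weil_class_local[OF rel, of ls s] assms(1) valid by (auto simp: add.assoc)
qed

text \<open>Counting replaces surjectivity: an injection into a finite set that is no larger is
  onto.\<close>

lemma graph_isoI:
  assumes "unitrivalent G" "inj_on f (half_edges G)" "f ` half_edges G \<subseteq> half_edges G'"
    "card (half_edges G') \<le> card (half_edges G)" "finite (half_edges G')"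
    "\<And>h. h \<in> half_edges G \<Longrightarrow> f (rot G h) = rot G' (f h) \<and> f (opp G h) = opp G' (f h)"
  shows "graph_iso f G G'"
proof -
  have "f ` half_edges G = half_edges G'"
    using assms by (intro card_seteq) (auto simp: card_image)
  then show ?thesis
    using assms unfolding graph_iso_def bij_betw_def by blast
qed

text \<open>The new vertex \<open>(ForkL, EndL, ForkR)\<close> sits on the edge at \<open>x\<close>, with \<open>ForkR\<close> facing \<open>x\<close>;
  the half-edge \<open>EndL\<close> leads to the new degree-1 vertex \<open>EndR\<close>.\<close>

fun graft_rot :: "ugraph \<Rightarrow> half_edge \<Rightarrow> half_edge" where
  "graft_rot G (Old h) = Old (rot G h)"
| "graft_rot G (ForkL h) = EndL h"
| "graft_rot G (EndL h) = ForkR h"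
| "graft_rot G (ForkR h) = ForkL h"
| "graft_rot G h = h"

fun graft_opp :: "half_edge \<Rightarrow> ugraph \<Rightarrow> half_edge \<Rightarrow> half_edge" where
  "graft_opp x G (Old h) = (if h = x then ForkR (Atom 0)
     else if h = opp G x then ForkL (Atom 0) else Old (opp G h))"
| "graft_opp x G (ForkL h) = Old (opp G x)"
| "graft_opp x G (ForkR h) = Old x"
| "graft_opp x G (EndL h) = EndR h"
| "graft_opp x G (EndR h) = EndL h"
| "graft_opp x G h = h"

text \<open>The label \<open>Atom 0\<close> of the new half-edges does not depend on
  \<open>x\<close>. Hence all grafts on \<open>G\<close> share their half-edges, legs and special
  vertex, and the isomorphisms between them move only a few half-edges.\<close>

definition graft :: "half_edge \<Rightarrow> ugraph \<Rightarrow> ugraph" where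
  "graft x G = \<lparr>
     half_edges = Old ` half_edges G \<union> {ForkL (Atom 0), ForkR (Atom 0), EndL (Atom 0), EndR (Atom 0)},
     rot = graft_rot G,
     opp = graft_opp x G\<rparr>"

lemma graft_sel [simp]:
  "half_edges (graft x G) = Old ` half_edges G \<union> {ForkL (Atom 0), ForkR (Atom 0), EndL (Atom 0), EndR (Atom 0)}"
  "rot (graft x G) = graft_rot G"
  "opp (graft x G) = graft_opp x G"
  by (simp_all add: graft_def)

lemma unitrivalent_graft:
  assumes "unitrivalent G" "x \<in> half_edges G"
  shows "unitrivalent (graft x G)"
proof -
  have "graft_opp x G h \<in> half_edges (graft x G) \<and> graft_opp x G (graft_opp x G h) = h \<and>
      graft_opp x G h \<noteq> h" if "h \<in> half_edges (graft x G)" for h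
    using that assms unitrivalentD[OF assms(1)] by (auto dest: unitrivalent_eq_iff(2)[OF assms(1), THEN iffD1, rotated 2] split: if_splits)
  then show ?thesis
    using assms unfolding unitrivalent_def by auto
qed

lemma univalent_graft: "univalent (graft x G) = Old ` univalent G \<union> {EndR (Atom 0)}"
  by (auto simp: univalent_def)

lemma weil_diagram_graft:
  assumes "weil_diagram (Weil G ls None)" "x \<in> half_edges G"
  shows "weil_diagram (Weil (graft x G) (old_legs ls) (Some (EndR (Atom 0))))"
proof -
  have "map fst (old_legs ls) = map Old (map fst ls)"
    by simp
  then have "distinct (map fst (old_legs ls))"
    using assms(1) unfolding weil_diagram_def by (simp only: distinct_map) (auto simp: inj_on_def)
  moreover have "fst ` set (old_legs ls) = Old ` univalent G"
    using assms(1) by (auto simp: weil_diagram_def image_image)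
  ultimately show ?thesis
    using assms unfolding weil_diagram_def
    by (auto simp: unitrivalent_graft univalent_graft image_image)
qed

text \<open>Seen from the other end of the edge, the new edge leaves on the other side: exchanging
  \<open>ForkL\<close> and \<open>ForkR\<close> reverses the new vertex, and AS gives the
  sign.\<close>

lemma weil_class_graft_opp:
  assumes D: "weil_diagram (Weil G ls None)" and x: "x \<in> half_edges G"
  shows "weil_class (Weil (graft (opp G x) G) (old_legs ls) (Some (EndR (Atom 0))))
    = - weil_class (Weil (graft x G) (old_legs ls) (Some (EndR (Atom 0))))"
proof -
  have G: "unitrivalent G"
    using D by (simp add: weil_diagram_def)
  then have ox: "opp G x \<in> half_edges G" "opp G (opp G x) = x" "opp G x \<noteq> x" "finite (half_edges G)"
    using x by (auto simp: unitrivalent_def)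
  let ?f = "id(ForkL (Atom 0) := ForkR (Atom 0), ForkR (Atom 0) := ForkL (Atom 0))"
  note rev = weil_class_reverse_at[OF weil_diagram_graft[OF D x], of "EndL (Atom 0)"]
  have "graph_iso ?f (graft (opp G x) G) (reverse_at (EndL (Atom 0)) (graft x G))"
    by (rule graph_isoI) (use G ox in \<open>auto simp: unitrivalent_graft inj_on_def reverse_at_def split: if_splits\<close>)
  then have "weil_class (Weil (graft (opp G x) G) (old_legs ls) (Some (EndR (Atom 0))))
    = weil_class (Weil (reverse_at (EndL (Atom 0)) (graft x G)) (old_legs ls) (Some (EndR (Atom 0))))"
    by (intro weil_class_iso[of _ _ ?f] weil_diagram_graft[OF D ox(1)] rev)
      (auto simp: weil_iso_def)
  also have "\<dots> = - weil_class (Weil (graft x G) (old_legs ls) (Some (EndR (Atom 0))))"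
    by (rule rev) auto
  finally show ?thesis .
qed

lemma inj_three_cycle:
  assumes "distinct [a, b, c]"
  shows "inj (id(a := b, b := c, c := a))"
  using assms by (auto simp: inj_def)

text \<open>In either graft \<open>ForkR\<close> faces the chosen half-edge, so \<open>Old x\<close>
  goes to \<open>Old w\<close>. The far end of the edge of \<open>x\<close> is faced by
  \<open>ForkL\<close> before and by \<open>Old x\<close> after; that of \<open>w\<close> by
  \<open>Old w\<close> before and by \<open>ForkL\<close> after. The case distinctions allow
  \<open>x\<close> and \<open>w\<close> to be the two halves of one edge.\<close>

lemma graft_opp_three_cycle:
  assumes G: "unitrivalent G" and "x \<in> half_edges G" "w \<in> half_edges G" "x \<noteq> w"
    and h: "h \<in> half_edges (graft x G)"
  defines "f \<equiv> id(ForkL (Atom 0) := Old x, Old x := Old w, Old w := ForkL (Atom 0))"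
  shows "f (graft_opp x G h) = graft_opp w G (f h)"
proof -
  note [simp] = unitrivalentD[OF G] unitrivalent_eq_iff(2)[OF G] assms(2-4) assms(4)[symmetric]
  have f: "f (ForkL (Atom 0)) = Old x" "f (Old x) = Old w" "f (Old w) = ForkL (Atom 0)"
    "\<And>h. h \<noteq> ForkL (Atom 0) \<Longrightarrow> h \<noteq> Old x \<Longrightarrow> h \<noteq> Old w \<Longrightarrow> f h = h"
    by (simp_all add: f_def)
  consider "h = Old x" | "h = Old w" | k where "h = Old k" "k \<in> half_edges G" "k \<noteq> x" "k \<noteq> w"
    | "h = ForkL (Atom 0)" | "h \<in> {ForkR (Atom 0), EndL (Atom 0), EndR (Atom 0)}"
    using h by auto
  then show ?thesis
  proof cases
    case 2
    have "opp G w \<noteq> x" if "w \<noteq> opp G x"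
      using that by (metis assms(3) unitrivalentD(4)[OF G])
    then show ?thesis
      unfolding 2 f(3) by (cases "w = opp G x") (simp_all add: f)
  next
    case (3 k)
    have "opp G k \<noteq> x" if "k \<noteq> opp G x"
      using that by (metis 3(2) unitrivalentD(4)[OF G])
    moreover have "opp G k = w \<longleftrightarrow> k = opp G w"
      using 3 by auto
    ultimately show ?thesis
      unfolding 3(1) using 3 by (cases "k = opp G x"; cases "k = opp G w") (simp_all add: f)
  next
    case 4
    have "opp G x = w \<longleftrightarrow> x = opp G w"
      by (metis assms(2,3) unitrivalentD(4)[OF G])
    then show ?thesis
      unfolding 4 by (cases "opp G x = w") (simp_all add: f)
  qed (auto simp: f)
qed

text \<open>\<open>T\<close> stands for a further term of an IHX relation, which differs from
  \<open>graft x G\<close> in \<open>rot\<close> only.\<close>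

lemma graph_iso_three_cycle:
  assumes G: "unitrivalent G" "x \<in> half_edges G" "w \<in> half_edges G" "x \<noteq> w"
    and T: "unitrivalent T" "half_edges T = half_edges (graft x G)" "opp T = opp (graft x G)"
  defines "f \<equiv> id(ForkL (Atom 0) := Old x, Old x := Old w, Old w := ForkL (Atom 0))"
  assumes rot: "\<And>h. h \<in> half_edges T \<Longrightarrow> f (rot T h) = graft_rot G (f h)"
  shows "graph_iso f T (graft w G)"
proof (rule graph_isoI)
  show "inj_on f (half_edges T)"
    unfolding f_def using G(4) by (intro inj_on_subset[OF inj_three_cycle]) auto
  show "f ` half_edges T \<subseteq> half_edges (graft w G)"
    unfolding T(2) using G by (auto simp: f_def)
  show "f (rot T h) = rot (graft w G) (f h) \<and> f (opp T h) = opp (graft w G) (f h)" if "h \<in> half_edges T" for h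
    using rot[OF that] graft_opp_three_cycle[OF G] that unfolding T(2) T(3) f_def by simp
  show "card (half_edges (graft w G)) \<le> card (half_edges T)"
    by (simp add: T(2))
qed (use T G(1) in \<open>simp_all add: unitrivalent_def\<close>)

text \<open>IHX for the edge between the vertex of \<open>x\<close> and the new vertex slides the
  new edge across that vertex. Up to a three-cycle of half-edges, the other two terms are the grafts
  at the other two half-edges of the vertex.\<close>

lemma weil_class_graft_rot:
  assumes D: "weil_diagram (Weil G ls None)" and x: "x \<in> half_edges G" "rot G x \<noteq> x"
  defines "A \<equiv> \<lambda>x. weil_class (Weil (graft x G) (old_legs ls) (Some (EndR (Atom 0))))"
  shows "A x + A (rot G x) + A (rot G (rot G x)) = 0"
proof -
  have G: "unitrivalent G" and legs: "fst ` set ls = univalent G"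
    using D by (simp_all add: weil_diagram_def)
  define y z where "y = rot G x" and "z = rot G y"
  have xyz: "y \<in> half_edges G" "z \<in> half_edges G" "rot G x = y" "rot G y = z" "rot G z = x"
    "x \<noteq> y" "y \<noteq> z" "x \<noteq> z" "finite (half_edges G)"
    using x G unfolding y_def z_def unitrivalent_def by metis+
  have rot_iff: "rot G h = x \<longleftrightarrow> h = z" "rot G h = y \<longleftrightarrow> h = x" "rot G h = z \<longleftrightarrow> h = y"
    if "h \<in> half_edges G" for h
    using unitrivalent_eq_iff(1)[OF G that] xyz x(1) by metis+
  have not_legs: "x \<notin> fst ` set ls" "y \<notin> fst ` set ls" "z \<notin> fst ` set ls"
    using xyz unfolding legs by (auto simp: univalent_def)
  let ?P = "ForkL (Atom 0)" and ?Q = "ForkR (Atom 0)" and ?R = "EndL (Atom 0)" and ?S = "EndR (Atom 0)"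
  let ?G = "graft x G"
  note valid = weil_diagram_graft[OF D x(1)]
  note ihx = weil_class_IHX[OF valid, of "Old x" ?Q "Old y" "Old z" ?P ?R]
  have ihx1: "weil_diagram (Weil (tree_T ?G (Old x) ?Q (Old z) ?P (Old y) ?R) (old_legs ls) (Some ?S))"
    by (rule ihx) (use xyz x in auto)
  have ihx2: "weil_diagram (Weil (tree_T ?G (Old x) ?Q ?P (Old y) (Old z) ?R) (old_legs ls) (Some ?S))"
    by (rule ihx) (use xyz x in auto)
  have 0: "A x + weil_class (Weil (tree_T ?G (Old x) ?Q (Old z) ?P (Old y) ?R) (old_legs ls) (Some ?S))
     + weil_class (Weil (tree_T ?G (Old x) ?Q ?P (Old y) (Old z) ?R) (old_legs ls) (Some ?S)) = 0"
    unfolding A_def by (rule ihx) (use xyz x in auto)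
  \<comment> \<open>The cycle moves only half-edges at trivalent vertices, so the ordered legs stay
    put.\<close>
  have legs_id: "map (apfst (id(?P := Old x, Old x := Old w, Old w := ?P))) (old_legs ls) = old_legs ls"
    if "w \<in> {y, z}" for w
    using not_legs that by (force simp: fun_upd_def)
  have 1: "weil_class (Weil (tree_T ?G (Old x) ?Q (Old z) ?P (Old y) ?R) (old_legs ls) (Some ?S)) = A y"
    unfolding A_def
  proof (rule weil_class_iso[OF ihx1 weil_diagram_graft[OF D xyz(1)]])
    have "graph_iso (id(?P := Old x, Old x := Old y, Old y := ?P))
        (tree_T ?G (Old x) ?Q (Old z) ?P (Old y) ?R) (graft y G)"
      by (rule graph_iso_three_cycle[OF G x(1)])
        (use ihx1 xyz rot_iff in \<open>auto simp: tree_T_def weil_diagram_def\<close>)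
    then show "weil_iso (id(?P := Old x, Old x := Old y, Old y := ?P))
        (Weil (tree_T ?G (Old x) ?Q (Old z) ?P (Old y) ?R) (old_legs ls) (Some ?S))
        (Weil (graft y G) (old_legs ls) (Some ?S))"
      using legs_id[of y] by (simp add: weil_iso_def)
  qed
  have 2: "weil_class (Weil (tree_T ?G (Old x) ?Q ?P (Old y) (Old z) ?R) (old_legs ls) (Some ?S)) = A z"
    unfolding A_def
  proof (rule weil_class_iso[OF ihx2 weil_diagram_graft[OF D xyz(2)]])
    have "graph_iso (id(?P := Old x, Old x := Old z, Old z := ?P))
        (tree_T ?G (Old x) ?Q ?P (Old y) (Old z) ?R) (graft z G)"
      by (rule graph_iso_three_cycle[OF G x(1)])
        (use ihx2 xyz rot_iff in \<open>auto simp: tree_T_def weil_diagram_def\<close>)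
    then show "weil_iso (id(?P := Old x, Old x := Old z, Old z := ?P))
        (Weil (tree_T ?G (Old x) ?Q ?P (Old y) (Old z) ?R) (old_legs ls) (Some ?S))
        (Weil (graft z G) (old_legs ls) (Some ?S))"
      using legs_id[of z] by (simp add: weil_iso_def)
  qed
  show ?thesis
    using 0 unfolding 1 2 by (simp add: y_def z_def)
qed

text \<open>On the edge of a leg, attaching and grafting agree. This embeds the sum over the legs in
  a sum over all half-edges.\<close>

lemma attach_graft:
  assumes D: "weil_diagram (Weil G (us @ (h, g) # vs) None)"
  shows "attach G us h g vs
    = weil_class (Weil (graft h G) (old_legs (us @ (h, g) # vs)) (Some (EndR (Atom 0))))"
proof -
  let ?ls = "us @ (h, g) # vs"
  have G: "unitrivalent G" and legs: "fst ` set ?ls = univalent G"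
    and dist: "distinct (map fst ?ls)" and gr: "snd ` set ?ls \<subseteq> {1, 2}"
    using D by (auto simp: weil_diagram_def)
  have h: "h \<in> half_edges G" "rot G h = h"
    using legs by (auto simp: univalent_def)
  \<comment> \<open>The stem \<open>Old h\<close> of the sprout becomes \<open>ForkL\<close>, on the
    far side of the new vertex from the leg, and the new leg \<open>EndR h\<close> becomes the leg
    \<open>Old h\<close>; the cyclic order (stem, left, right) goes to (\<open>ForkL\<close>,
    \<open>EndL\<close>, \<open>ForkR\<close>).\<close>
  define f where "f = (\<lambda>k. case k of Old y \<Rightarrow> if y = h then ForkL (Atom 0) else Old y
    | EndR y \<Rightarrow> Old h | ForkR y \<Rightarrow> ForkR (Atom 0) | ForkL y \<Rightarrow> EndL (Atom 0) | EndL y \<Rightarrow> EndR (Atom 0)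
    | Atom n \<Rightarrow> Atom n)"
  have f [simp]: "f (Old y) = (if y = h then ForkL (Atom 0) else Old y)" "f (EndR y) = Old h"
    "f (ForkR y) = ForkR (Atom 0)" "f (ForkL y) = EndL (Atom 0)" "f (EndL y) = EndR (Atom 0)" for y
    by (simp_all add: f_def)
  note GD = unitrivalentD[OF G] unitrivalent_eq_iff[OF G]
  have iso: "graph_iso f (sprout {h} G) (graft h G)"
  proof (rule graph_isoI)
    show "unitrivalent (sprout {h} G)"
      using G h by (intro unitrivalent_sprout) (auto simp: univalent_def)
    show "inj_on f (half_edges (sprout {h} G))"
      by (rule inj_onI) (auto simp: sprout_def split: if_splits)
    show "f ` half_edges (sprout {h} G) \<subseteq> half_edges (graft h G)"
      using h by (auto simp: sprout_def split: if_splits)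
    have "finite (half_edges G)"
      using G by (simp add: unitrivalent_def)
    then show "card (half_edges (graft h G)) \<le> card (half_edges (sprout {h} G))"
      by (simp add: sprout_def card_insert_if image_iff)
    show "finite (half_edges (graft h G))"
      using \<open>finite (half_edges G)\<close> by simp
    show "f (rot (sprout {h} G) k) = rot (graft h G) (f k) \<and> f (opp (sprout {h} G) k) = opp (graft h G) (f k)"
      if "k \<in> half_edges (sprout {h} G)" for k
    proof -
      have "rot G y \<noteq> h" if "y \<in> half_edges G" "y \<noteq> h" for y
        using GD(6)[of y h] h that by simp
      moreover have "opp G y = h \<longleftrightarrow> y = opp G h" if "y \<in> half_edges G" for y
        using GD(4) h that by metis
      ultimately show ?thesis
        using that h GD(5)[OF h(1)] GD(4)[OF h(1)] by (auto simp: sprout_def)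
    qed
  qed
  have legs_old: "map (apfst f) (old_legs xs) = old_legs xs" if "h \<notin> fst ` set xs" for xs :: "(half_edge \<times> nat) list"
  proof (rule map_idI)
    fix p
    assume "p \<in> set (old_legs xs)"
    then obtain y n where "p = (Old y, n)" "(y, n) \<in> set xs"
      by auto
    with that show "apfst f p = p"
      by (auto simp: image_iff)
  qed
  have "h \<notin> fst ` set us" "h \<notin> fst ` set vs"
    using dist by auto
  note old = this[THEN legs_old]
  have D': "weil_diagram (Weil (sprout {h} G) (old_legs us @ (EndR h, g) # old_legs vs) (Some (EndL h)))"
    using weil_diagram_iota2[OF D] gr by (auto simp: weil_diagram_def)
  have "weil_iso f (Weil (sprout {h} G) (old_legs us @ (EndR h, g) # old_legs vs) (Some (EndL h)))
      (Weil (graft h G) (old_legs (us @ (h, g) # vs)) (Some (EndR (Atom 0))))"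
    unfolding weil_iso_def weil.sel map_append list.map old using iso by simp
  then show ?thesis
    unfolding attach_def by (rule weil_class_iso[OF D' weil_diagram_graft[OF D h(1)]])
qed

lemma sum_uminus_self_eq_0:
  assumes "x = - x"
  shows "(x :: weil_space) = 0"
proof -
  have "scaleW 2 x = scaleW 1 x + scaleW 1 x"
    by (simp only: weil.scale_left_distrib[symmetric]) simp
  then have "scaleW 2 x = 0"
    using assms by (simp add: eq_neg_iff_add_eq_0)
  then show ?thesis
    by simp
qed

text \<open>Summing over all half-edges, the contributions of the two halves of each edge cancel, and so
  do those of the three half-edges at each trivalent vertex; the legs are what remains.\<close>

lemma invariance:
  assumes D: "weil_diagram (Weil G ls None)"
  shows "split_sum (\<lambda>us x vs. attach G us (fst x) (snd x) vs) ls = 0"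
proof -
  define A where "A x = weil_class (Weil (graft x G) (old_legs ls) (Some (EndR (Atom 0))))" for x
  have G: "unitrivalent G" and legs: "fst ` set ls = univalent G" and dist: "distinct (map fst ls)"
    using D by (auto simp: weil_diagram_def)
  have fin: "finite (half_edges G)"
    using G by (simp add: unitrivalent_def)
  let ?H = "half_edges G" and ?V = "half_edges G - univalent G"
  have "bij_betw (opp G) ?H ?H"
    by (rule bij_betw_byWitness[where f' = "opp G"]) (auto simp: unitrivalentD[OF G])
  then have "(\<Sum>x\<in>?H. A x) = (\<Sum>x\<in>?H. A (opp G x))"
    by (rule sum.reindex_bij_betw[symmetric])
  also have "\<dots> = - (\<Sum>x\<in>?H. A x)"
    unfolding sum_negf[symmetric] by (rule sum.cong) (use weil_class_graft_opp[OF D] in \<open>auto simp: A_def\<close>)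
  finally have edges: "(\<Sum>x\<in>?H. A x) = 0"
    by (rule sum_uminus_self_eq_0)
  have V: "rot G x \<in> ?V" if "x \<in> ?V" for x
    using that rot_in_univalent[OF G, of x] unitrivalentD(1)[OF G, of x]
    by (auto simp: univalent_def)
  have rot: "bij_betw (rot G) ?V ?V"
    by (rule bij_betw_byWitness[where f' = "\<lambda>x. rot G (rot G x)"])
      (use V in \<open>auto simp: unitrivalentD[OF G]\<close>)
  have rot1: "(\<Sum>x\<in>?V. A (rot G x)) = (\<Sum>x\<in>?V. A x)"
    using rot by (rule sum.reindex_bij_betw)
  have rot2: "(\<Sum>x\<in>?V. A (rot G (rot G x))) = (\<Sum>x\<in>?V. A x)"
    using sum.reindex_bij_betw[OF bij_betw_trans[OF rot rot], of A] by simp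
  \<comment> \<open>\<open>rot\<close> permutes the half-edges at trivalent vertices, so adding up
    the vertex relations counts each graft three times.\<close>
  have "(\<Sum>x\<in>?V. A x) + (\<Sum>x\<in>?V. A x) + (\<Sum>x\<in>?V. A x)
      = (\<Sum>x\<in>?V. A x + A (rot G x) + A (rot G (rot G x)))"
    by (simp add: sum.distrib rot1 rot2)
  also have "\<dots> = 0"
    by (rule sum.neutral) (use weil_class_graft_rot[OF D] in \<open>auto simp: A_def univalent_def\<close>)
  finally have "scaleW 3 (\<Sum>x\<in>?V. A x) = 0"
    using weil.scale_left_distrib[of 1 1] weil.scale_left_distrib[of 2 1] by simp
  then have vertices: "(\<Sum>x\<in>?V. A x) = 0"
    by simp
  have "split_sum (\<lambda>us x vs. attach G us (fst x) (snd x) vs) ls = split_sum (\<lambda>us x vs. A (fst x)) ls"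
    by (rule split_sum_cong) (use D attach_graft[of G] in \<open>auto simp: A_def\<close>)
  also have "\<dots> = (\<Sum>x\<in>univalent G. A x)"
    using sum_list_distinct_conv_sum_set[OF dist, of A]
    by (simp add: split_sum_const o_def flip: legs)
  also have "\<dots> = (\<Sum>x\<in>?H. A x) - (\<Sum>x\<in>?V. A x)"
    by (subst sum_diff[OF fin]) (auto simp: univalent_def)
  finally show ?thesis
    by (simp add: edges vertices)
qed


section \<open>The image of \<open>\<Upsilon>\<close> is basic\<close>

text \<open>The exchange of the two branches of the fork at \<open>h\<close>. It is an isomorphism
  onto the sprout from the sprout with that vertex reversed, hence the sign in
  \<open>weil_class_fork_swap\<close>.\<close>

definition fork_swap :: "half_edge \<Rightarrow> half_edge \<Rightarrow> half_edge" where
  "fork_swap h = id(ForkL h := ForkR h, ForkR h := ForkL h, EndL h := EndR h, EndR h := EndL h)"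

lemma fork_swap_twice: "fork_swap h (fork_swap h x) = x"
  by (simp add: fork_swap_def)

lemma fork_swap_simps [simp]:
  "fork_swap h (Old x) = Old x"
  "fork_swap h (EndL x) = (if x = h then EndR x else EndL x)"
  "fork_swap h (EndR x) = (if x = h then EndL x else EndR x)"
  "fork_swap h (ForkL x) = (if x = h then ForkR x else ForkL x)"
  "fork_swap h (ForkR x) = (if x = h then ForkL x else ForkR x)"
  by (simp_all add: fork_swap_def)

lemma weil_class_fork_swap:
  assumes D: "weil_diagram (Weil (sprout S G) ls s)" and S: "S \<subseteq> univalent G" "h \<in> S"
    and D': "weil_diagram (Weil (sprout S G) (map (apfst (fork_swap h)) ls) (map_option (fork_swap h) s))"
  shows "weil_class (Weil (sprout S G) (map (apfst (fork_swap h)) ls) (map_option (fork_swap h) s))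
    = - weil_class (Weil (sprout S G) ls s)"
proof -
  have h: "Old h \<in> half_edges (sprout S G)" "rot (sprout S G) (Old h) \<noteq> Old h"
    using S by (auto simp: sprout_def univalent_def)
  have T: "unitrivalent (sprout S G)"
    using D by (simp add: weil_diagram_def)
  note rev = weil_class_reverse_at[OF D h]
  have "graph_iso (fork_swap h) (reverse_at (Old h) (sprout S G)) (sprout S G)"
  proof (rule graph_isoI)
    show "inj_on (fork_swap h) (half_edges (reverse_at (Old h) (sprout S G)))"
      by (metis fork_swap_twice inj_onI)
    show "fork_swap h (rot (reverse_at (Old h) (sprout S G)) x) = rot (sprout S G) (fork_swap h x) \<and>
        fork_swap h (opp (reverse_at (Old h) (sprout S G)) x) = opp (sprout S G) (fork_swap h x)"
      if "x \<in> half_edges (reverse_at (Old h) (sprout S G))" for x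
      using that S by (cases x) (auto simp: reverse_at_def sprout_def)
  qed (use T rev S in \<open>auto simp: reverse_at_def sprout_def weil_diagram_def unitrivalent_def\<close>)
  then have "weil_class (Weil (sprout S G) (map (apfst (fork_swap h)) ls) (map_option (fork_swap h) s))
      = weil_class (Weil (reverse_at (Old h) (sprout S G)) ls s)"
    by (intro weil_class_iso[of _ _ "fork_swap h", symmetric] rev D') (simp add: weil_iso_def)
  then show ?thesis
    using rev by simp
qed

text \<open>Compares a sprout of a sprout with a single sprout: the second sprouting adds one more
  \<open>Old\<close>, outermost on the previous half-edges and below the constructor on those of the
  new fork.\<close>

fun unnest :: "half_edge \<Rightarrow> half_edge" where
  "unnest (Old x) = x"
| "unnest (ForkL x) = ForkL (unnest x)"
| "unnest (ForkR x) = ForkR (unnest x)"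
| "unnest (EndL x) = EndL (unnest x)"
| "unnest (EndR x) = EndR (unnest x)"
| "unnest (Atom n) = Atom n"

lemma graph_iso_unnest:
  assumes G: "unitrivalent G" and S: "insert h S \<subseteq> univalent G" "h \<notin> S"
  shows "graph_iso unnest (sprout {Old h} (sprout S G)) (sprout (insert h S) G)"
proof (rule graph_isoI)
  have S': "S \<subseteq> univalent G"
    using S by blast
  show T: "unitrivalent (sprout {Old h} (sprout S G))"
    using G S by (intro unitrivalent_sprout) (auto simp: univalent_sprout)
  show inj: "inj_on unnest (half_edges (sprout {Old h} (sprout S G)))"
    using S by (intro inj_onI) (auto simp: sprout_def)
  have im: "unnest ` half_edges (sprout {Old h} (sprout S G)) = half_edges (sprout (insert h S) G)"
    by (auto simp: sprout_def image_Un image_image)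
  then show "unnest ` half_edges (sprout {Old h} (sprout S G)) \<subseteq> half_edges (sprout (insert h S) G)"
    by simp
  show "card (half_edges (sprout (insert h S) G)) \<le> card (half_edges (sprout {Old h} (sprout S G)))"
    unfolding im[symmetric] using inj by (simp add: card_image)
  show "finite (half_edges (sprout (insert h S) G))"
    unfolding im[symmetric] using T by (simp add: unitrivalent_def)
  show "unnest (rot (sprout {Old h} (sprout S G)) x) = rot (sprout (insert h S) G) (unnest x) \<and>
      unnest (opp (sprout {Old h} (sprout S G)) x) = opp (sprout (insert h S) G) (unnest x)"
    if "x \<in> half_edges (sprout {Old h} (sprout S G))" for x
    using that S by (auto simp: sprout_def)
qed

lemma upsilon_legs_cong:
  "(\<And>h. h \<in> set hs \<Longrightarrow> h \<in> S \<longleftrightarrow> h \<in> T) \<Longrightarrow> upsilon_legs S hs = upsilon_legs T hs"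
  by (induction hs) auto

lemma unnest_old_legs: "map (apfst unnest) (old_legs ls) = ls"
  by (induction ls) auto

text \<open>Groups the legs of the expansion by the leg of the Jacobi diagram from which they
  come.\<close>

lemma split_sum_upsilon_legs:
  "split_sum f (upsilon_legs S hs) = split_sum (\<lambda>us h vs. split_sum (\<lambda>as x bs.
     f (upsilon_legs S us @ as) x (bs @ upsilon_legs S vs)) (upsilon_legs S [h])) hs"
proof (induction hs arbitrary: f)
  case (Cons h hs)
  have "split_sum f (upsilon_legs S ([h] @ hs)) = split_sum f (upsilon_legs S [h] @ upsilon_legs S hs)"
    by (simp only: upsilon_legs_simps)
  then show ?case
    by (simp add: split_sum_append Cons.IH)
qed simp

text \<open>The contributions of a leg \<open>h\<close> to the terms of \<open>S\<close> and \<open>insert h S\<close> cancel: two legs of the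
  fork at \<open>h\<close> can become the special vertex, with equal results, against the coefficient \<open>- 1 / 2\<close>.\<close>

lemma iota_W_Upsilon_class:
  assumes G: "unitrivalent G"
  shows "iota_W (Upsilon (jacobi_class G)) = 0"
proof -
  obtain hs where hs: "distinct hs" "set hs = univalent G"
    using exists_ordering[OF G] by blast
  define Z where "Z S us h vs = weil_class (Weil (sprout S G)
    (upsilon_legs S us @ (EndR h, 1) # upsilon_legs S vs) (Some (EndL h)))" for S us h vs
  have even: "parity (upsilon_legs S us) = 1" for S us
    by (simp add: grade_upsilon_legs)
  \<comment> \<open>At a fork, making the right end special instead of the left costs the sign of
    AS, and the left leg standing before it costs another, so the two terms agree. A grade 2 leg
    gives the same diagram once, with its fork newly created by \<open>\<iota>\<close>.\<close>
  have block: "split_sum (\<lambda>as x bs. scaleW (parity (upsilon_legs S us @ as))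
        (contract (sprout S G) (upsilon_legs S us @ as) x (bs @ upsilon_legs S vs))) (upsilon_legs S [h])
      = scaleW (if h \<in> S then 2 else 1) (Z (insert h S) us h vs)"
    if S: "S \<subseteq> univalent G" and split: "hs = us @ h # vs" for S us h vs
  proof (cases "h \<in> S")
    case True
    let ?us = "upsilon_legs S us" and ?vs = "upsilon_legs S vs"
    have D: "weil_diagram (Weil (sprout S G) (?us @ (EndL h, 1) # (EndR h, 1) # ?vs) None)"
      using weil_diagram_upsilon[OF G hs S] True unfolding split by simp
    have nh: "h \<notin> set us" "h \<notin> set vs"
      using hs(1) unfolding split by auto
    have fs: "map (apfst (fork_swap h)) (upsilon_legs S xs) = upsilon_legs S xs" if "h \<notin> set xs" for xs
      using that by (induction xs) auto
    have "weil_class (Weil (sprout S G) (?us @ (EndL h, 1) # ?vs) (Some (EndR h))) = - Z S us h vs"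
      using weil_class_fork_swap[OF weil_diagram_iota1[OF D, simplified] S True]
        weil_diagram_iota1[of _ "?us @ [(EndL h, 1)]" "EndR h" 1 ?vs] D
      by (simp add: fs nh Z_def)
    moreover have "insert h S = S"
      using True by blast
    ultimately show ?thesis
      using True even[of S us] weil.scale_left_distrib[of 1 1 "Z S us h vs"]
      by (simp add: contract_def Z_def)
  next
    case False
    have h: "insert h S \<subseteq> univalent G"
      using S hs(2) unfolding split by auto
    have nh: "h \<notin> set us" "h \<notin> set vs"
      using hs(1) unfolding split by auto
    have U: "upsilon_legs (insert h S) us = upsilon_legs S us" "upsilon_legs (insert h S) vs = upsilon_legs S vs"
      using nh by (auto intro!: upsilon_legs_cong)
    have D: "weil_diagram (Weil (sprout S G) (upsilon_legs S us @ (Old h, 2) # upsilon_legs S vs) None)"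
      using weil_diagram_upsilon[OF G hs S] False unfolding split by simp
    have D': "weil_diagram (Weil (sprout (insert h S) G)
        (upsilon_legs S us @ (EndL h, 1) # (EndR h, 1) # upsilon_legs S vs) None)"
      using weil_diagram_upsilon[OF G hs h] unfolding split by (simp add: U)
    let ?us = "upsilon_legs S us" and ?vs = "upsilon_legs S vs"
    have "weil_iso unnest (Weil (sprout {Old h} (sprout S G))
          (old_legs ?us @ (EndR (Old h), 1) # old_legs ?vs) (Some (EndL (Old h))))
        (Weil (sprout (insert h S) G) (?us @ (EndR h, 1) # ?vs) (Some (EndL h)))"
      unfolding weil_iso_def weil.sel map_append list.map unnest_old_legs
      using graph_iso_unnest[OF G h False] by simp
    then have "attach (sprout S G) ?us (Old h) 1 ?vs = Z (insert h S) us h vs"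
      unfolding attach_def Z_def U
      by (rule weil_class_iso[OF weil_diagram_iota2[OF D] weil_diagram_iota1[OF D']])
    then show ?thesis
      using False even[of S us] by (simp add: contract_def)
  qed
  have "iota_W (weil_class (Weil (sprout S G) (upsilon_legs S hs) None))
      = split_sum (\<lambda>us h vs. scaleW (if h \<in> S then 2 else 1) (Z (insert h S) us h vs)) hs"
    if "S \<subseteq> univalent G" for S
    unfolding iota_W_Weil
    by (rule trans[OF split_sum_upsilon_legs]) (intro split_sum_cong refl block[OF that])
  then have "iota_W (Upsilon (jacobi_class G)) = (\<Sum>S\<in>Pow (univalent G). scaleW ((- 1 / 2) ^ card S)
      (split_sum (\<lambda>us h vs. scaleW (if h \<in> S then 2 else 1) (Z (insert h S) us h vs)) hs))"
    unfolding Upsilon_class[OF G hs] iota_W.sum iota_W.scale by (intro sum.cong) auto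
  also have "\<dots> = split_sum (\<lambda>us h vs. \<Sum>S\<in>Pow (univalent G).
      scaleW ((- 1 / 2) ^ card S * (if h \<in> S then 2 else 1)) (Z (insert h S) us h vs)) hs"
    unfolding split_sum_scaleW weil.scale_scale by (rule sum_split_sum)
  also have "\<dots> = split_sum (\<lambda>us h vs. 0) hs"
  proof (rule split_sum_cong[OF refl])
    fix us h vs
    assume "hs = us @ h # vs"
    then have h: "h \<in> univalent G"
      using hs(2) by auto
    define A where "A = univalent G - {h}"
    have A: "univalent G = insert h A" "h \<notin> A" "finite A"
      using h G by (auto simp: A_def unitrivalent_def univalent_def)
    have "inj_on (insert h) (Pow A)"
      using A(2) by (intro inj_onI) (metis PowD insert_ident subsetD)
    moreover have "Pow A \<inter> insert h ` Pow A = {}"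
      using A(2) by auto
    ultimately have "(\<Sum>S\<in>Pow (univalent G).
        scaleW ((- 1 / 2) ^ card S * (if h \<in> S then 2 else 1)) (Z (insert h S) us h vs))
      = (\<Sum>S\<in>Pow A. scaleW ((- 1 / 2) ^ card S * (if h \<in> S then 2 else 1)) (Z (insert h S) us h vs)
          + scaleW ((- 1 / 2) ^ card (insert h S) * 2) (Z (insert h S) us h vs))"
      unfolding A(1) Pow_insert using A(3)
      by (simp add: sum.union_disjoint sum.reindex sum.distrib)
    also have "\<dots> = 0"
    proof (rule sum.neutral, intro ballI)
      fix S
      assume "S \<in> Pow A"
      then have "h \<notin> S" "finite S"
        using A finite_subset by auto
      then show "scaleW ((- 1 / 2) ^ card S * (if h \<in> S then 2 else 1)) (Z (insert h S) us h vs)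
          + scaleW ((- 1 / 2) ^ card (insert h S) * 2) (Z (insert h S) us h vs) = 0"
        by (simp flip: weil.scale_left_distrib)
    qed
    finally show "(\<Sum>S\<in>Pow (univalent G).
        scaleW ((- 1 / 2) ^ card S * (if h \<in> S then 2 else 1)) (Z (insert h S) us h vs)) = 0" .
  qed
  finally show ?thesis
    by simp
qed


section \<open>The kernel of \<open>\<iota>\<close>\<close>

fun kappa_diagram :: "weil \<Rightarrow> weil free" where
  "kappa_diagram (Weil G ls None) = 0"
| "kappa_diagram (Weil G ls (Some h)) = gen (Weil G ((h, 1) # ls) None)"

lemma weil_diagram_kappa:
  "weil_diagram (Weil G ls (Some h)) \<Longrightarrow> weil_diagram (Weil G ((h, 1) # ls) None)"
  by (auto simp: weil_diagram_def)

lemma kappa_relations: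
  assumes "r \<in> weil_relations"
  shows "lin_ext kappa_diagram r \<in> free_span weil_relations"
proof -
  consider (iso) D D' f where "r = gen D - gen D'" "weil_diagram D" "weil_diagram D'" "weil_iso f D D'"
    | (loc) Gs ls s where "r = (\<Sum>G\<leftarrow>Gs. gen (Weil G ls s))" "local_relation Gs"
        "\<And>G. G \<in> set Gs \<Longrightarrow> weil_diagram (Weil G ls s)"
    | (perm) G xs k x l y ys s where
        "r = gen (Weil G (xs @ [(k, x), (l, y)] @ ys) s)
          - smult ((-1) ^ (x * y)) (gen (Weil G (xs @ [(l, y), (k, x)] @ ys) s))"
        "weil_diagram (Weil G (xs @ [(k, x), (l, y)] @ ys) s)"
    using assms unfolding weil_relations_def by blast
  then have "abs_weil_space (lin_ext kappa_diagram r) = 0"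
  proof cases
    case iso
    obtain G ls s G' ls' s' where D: "D = Weil G ls s" "D' = Weil G' ls' s'"
      by (meson weil.exhaust)
    have f: "ls' = map (apfst f) ls" "s' = map_option f s" "graph_iso f G G'"
      using iso(4) by (simp_all add: D weil_iso_def)
    show ?thesis
    proof (cases s)
      case None
      then show ?thesis
        by (simp add: iso(1) D f lin_ext.diff abs_weil_space_0)
    next
      case (Some h)
      have "weil_class (Weil G ((h, 1) # ls) None) = weil_class (Weil G' ((f h, 1) # ls') None)"
        by (rule weil_class_iso[where f = f])
          (use iso D f Some in \<open>auto simp: weil_iso_def intro!: weil_diagram_kappa simp del: One_nat_def\<close>)
      then show ?thesis
        by (simp add: iso(1) D f(2) Some lin_ext.diff abs_weil_space_simps)
    qed
  next
    case loc
    show ?thesis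
    proof (cases s)
      case None
      then show ?thesis
        by (simp add: loc(1) lin_ext_sum_list abs_weil_space_simps o_def)
    next
      case (Some h)
      have "(\<Sum>G\<leftarrow>Gs. weil_class (Weil G ((h, 1) # ls) None)) = 0"
        by (rule weil_class_local[OF loc(2)]) (use loc(3) Some in \<open>auto intro!: weil_diagram_kappa simp del: One_nat_def\<close>)
      then show ?thesis
        by (simp add: loc(1) Some lin_ext_sum_list abs_weil_space_simps o_def)
    qed
  next
    case perm
    show ?thesis
    proof (cases s)
      case None
      then show ?thesis
        by (simp add: perm(1) lin_ext.diff lin_ext_smult abs_weil_space_0)
    next
      case (Some h)
      have "weil_diagram (Weil G (((h, 1) # xs) @ [(k, x), (l, y)] @ ys) None)"
        using weil_diagram_kappa[of G _ h] perm(2) Some by simp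
      from weil_class_perm[OF this] show ?thesis
        by (simp add: perm(1) Some lin_ext.diff lin_ext_smult abs_weil_space_simps)
    qed
  qed
  then show ?thesis
    by (simp only: abs_weil_space_eq_0)
qed

lift_definition kappa :: "weil_space \<Rightarrow> weil_space" is "lin_ext kappa_diagram"
  by (rule lin_ext_weil_equiv) (rule kappa_relations)

lemma linear_kappa: "Vector_Spaces.linear scaleW scaleW kappa"
  by unfold_locales
    (transfer; simp add: lin_ext_add lin_ext_smult weil_equiv_def free.span_zero)+

interpretation kappa: Vector_Spaces.linear scaleW scaleW kappa
  by (rule linear_kappa)

lemma kappa_class: "kappa (weil_class (Weil G ls (Some h))) = weil_class (Weil G ((h, 1) # ls) None)"
  by (simp add: weil_class_def kappa.abs_eq)

lemma weil_diagram_fork: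
  assumes "weil_diagram (Weil G (us @ (h, g) # vs) None)"
  shows "weil_diagram (Weil (sprout {h} G)
    (old_legs us @ (EndL h, 1) # (EndR h, 1) # old_legs vs) None)"
proof -
  have "weil_diagram (Weil (sprout {h} G)
      ((EndL h, 1) # old_legs us @ (EndR h, 1) # old_legs vs) None)"
    by (intro weil_diagram_kappa weil_diagram_iota2[OF assms])
  then show ?thesis
    by (subst weil_diagram_mset) auto
qed

text \<open>Moving the new first leg back to the position acted on costs \<open>parity us\<close>,
  which is also the sign of that term in \<open>\<iota>\<close>. The composite is therefore free of
  signs and reproduces the diagram at every grade 1 leg.\<close>

lemma kappa_iota_W_class:
  assumes D: "weil_diagram (Weil G ls None)"
  shows "kappa (iota_W (weil_class (Weil G ls None))) = split_sum (\<lambda>us x vs.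
    if snd x = 1 then weil_class (Weil G ls None)
    else weil_class (Weil (sprout {fst x} G)
      (old_legs us @ (EndL (fst x), 1) # (EndR (fst x), 1) # old_legs vs) None)) ls"
proof -
  have move: "scaleW (parity us) (weil_class (Weil G ((h, 1) # us @ vs) None))
      = weil_class (Weil G (us @ (h, 1) # vs) None)"
    if "weil_diagram (Weil G (us @ (h, 1) # vs) None)" for G us h vs
  proof -
    have "weil_diagram (Weil G ((h, 1) # us @ vs) None)"
      using that by (subst weil_diagram_mset) auto
    then show ?thesis
      using weil_class_move[of G "[]" "(h, 1)" us vs None] by (simp add: minus_one_power_square)
  qed
  have "kappa (scaleW (parity us) (contract G us x vs)) = (if snd x = 1 then weil_class (Weil G ls None)
      else weil_class (Weil (sprout {fst x} G)
        (old_legs us @ (EndL (fst x), 1) # (EndR (fst x), 1) # old_legs vs) None))"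
    if ls: "ls = us @ x # vs" for us x vs
  proof (cases "snd x = 1")
    case True
    then show ?thesis
      using move[of G us "fst x" vs] D prod.collapse[of x]
      by (simp add: contract_def kappa_class kappa.scale ls del: prod.collapse)
  next
    case False
    have "weil_diagram (Weil (sprout {fst x} G)
        (old_legs us @ (EndL (fst x), 1) # (EndR (fst x), 1) # old_legs vs) None)"
      using weil_diagram_fork[of G us "fst x" "snd x" vs] D by (simp add: ls)
    from move[OF this] False show ?thesis
      by (simp add: contract_def attach_def kappa_class kappa.scale o_def)
  qed
  then show ?thesis
    unfolding iota_W_Weil split_sum_hom[where h = kappa, OF kappa.add kappa.zero]
    by (intro split_sum_cong refl)
qed

section \<open>Filtration by the number of grade 2 legs, and injectivity of
  \<open>\<iota>\<close>\<close>

definition even_legs :: "(half_edge \<times> nat) list \<Rightarrow> nat" where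
  "even_legs ls = length (filter (\<lambda>x. snd x = 2) ls)"

lemma even_legs_simps [simp]:
  "even_legs [] = 0"
  "even_legs (x # ls) = (if snd x = 2 then Suc (even_legs ls) else even_legs ls)"
  "even_legs (ls @ ls') = even_legs ls + even_legs ls'"
  "even_legs (map (apfst f) ls) = even_legs ls"
  by (simp_all add: even_legs_def filter_map o_def)

text \<open>The strict bound makes step 0 the zero space, where the descent in
  \<open>iota_W_injective_filtration\<close> ends.\<close>

definition W_filtration :: "int \<Rightarrow> nat \<Rightarrow> weil_space set" where
  "W_filtration i m = weil_span {weil_class D | D. weil_diagram D \<and> special D = None \<and>
     leg_grade D = i \<and> even_legs (legs D) < m}"

lemma subspace_W_filtration: "weil.subspace (W_filtration i m)"
  unfolding W_filtration_def by (rule weil.subspace_span)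

lemma W_filtration_mono: "m \<le> n \<Longrightarrow> W_filtration i m \<subseteq> W_filtration i n"
  unfolding W_filtration_def by (intro weil.span_mono) (force intro: less_le_trans)

lemma W_filtration_class:
  "\<lbrakk>weil_diagram (Weil G ls None); int (sum_list (map snd ls)) = i; even_legs ls < m\<rbrakk>
    \<Longrightarrow> weil_class (Weil G ls None) \<in> W_filtration i m"
  unfolding W_filtration_def by (rule weil.span_base) (force simp: leg_grade_def)

lemma W_filtration_induct [consumes 1, case_names zero step]:
  assumes "x \<in> W_filtration i m" and "P 0"
    and "\<And>c G ls y. \<lbrakk>weil_diagram (Weil G ls None); int (sum_list (map snd ls)) = i;
      even_legs ls < m; P y\<rbrakk> \<Longrightarrow> P (scaleW c (weil_class (Weil G ls None)) + y)"
  shows "P x"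
  using assms(1) unfolding W_filtration_def
proof (induction rule: weil.span_induct_alt)
  case base
  then show ?case using assms(2) by simp
next
  case (step c x y)
  then obtain D where "x = weil_class D" "weil_diagram D" "special D = None"
    "leg_grade D = i" "even_legs (legs D) < m"
    by blast
  then show ?case
    using assms(3)[of "graph D" "legs D" y c] step(2) by (cases D) (simp add: leg_grade_def)
qed

lemma W_filtration_0: "W_filtration i 0 = {0}"
  by (simp add: W_filtration_def)

lemma grade_even_legs:
  "snd ` set ls \<subseteq> {1, 2} \<Longrightarrow> sum_list (map snd ls) + even_legs ls = 2 * even_legs ls + length ls"
  by (induction ls) auto

lemma even_legs_le_length: "even_legs ls \<le> length ls"
  by (simp add: even_legs_def)

text \<open>A crude bound suffices: at most \<open>i\<close> legs have grade 2, and for negative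
  \<open>i\<close> there are no diagrams.\<close>

lemma W_grade_filtration: "W_grade i = W_filtration i (nat i + 1)"
proof -
  have "even_legs (legs D) < nat i + 1" if "weil_diagram D" "leg_grade D = i" for D
  proof -
    have "snd ` set (legs D) \<subseteq> {1, 2}"
      using that(1) by (simp add: weil_diagram_def)
    then show ?thesis
      using grade_even_legs[of "legs D"] even_legs_le_length[of "legs D"] that(2)
      by (simp add: leg_grade_def)
  qed
  then show ?thesis
    unfolding W_grade_def W_filtration_def by (intro arg_cong[where f = weil_span]) blast
qed

lemma split_sum_mem:
  assumes "weil.subspace V" "\<And>us x vs. ls = us @ x # vs \<Longrightarrow> f us x vs \<in> V"
  shows "split_sum f ls \<in> V"
  using assms(2)
proof (induction ls arbitrary: f)
  case Nil
  then show ?case by (simp add: weil.subspace_0[OF assms(1)])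
next
  case (Cons y ls)
  have "split_sum (\<lambda>us. f (y # us)) ls \<in> V"
    by (rule Cons.IH) (use Cons.prems in auto)
  then show ?case
    using Cons.prems[of "[]"] weil.subspace_add[OF assms(1)] by simp
qed

text \<open>Each of the \<open>i - 2 * even_legs ls\<close> legs of grade 1 reproduces the diagram;
  each leg of grade 2 becomes a fork, which lowers \<open>even_legs\<close> by one.\<close>

lemma kappa_iota_W_triangular_class:
  assumes D: "weil_diagram (Weil G ls None)" and i: "int (sum_list (map snd ls)) = i"
  shows "kappa (iota_W (weil_class (Weil G ls None)))
      - scaleW (of_int (i - 2 * int (even_legs ls))) (weil_class (Weil G ls None))
    \<in> W_filtration i (even_legs ls)"
proof -
  let ?w = "weil_class (Weil G ls None)"
  have gr: "snd ` set ls \<subseteq> {1, 2}"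
    using D by (simp add: weil_diagram_def)
  define X where "X us x vs = weil_class (Weil (sprout {fst x} G)
      (old_legs us @ (EndL (fst x), 1) # (EndR (fst x), 1) # old_legs vs) None)" for us vs and x :: "half_edge \<times> nat"
  have "split_sum (\<lambda>us x vs. if snd x = 1 then w else 0) ls
      = scaleW (of_int (int (sum_list (map snd ls)) - 2 * int (even_legs ls))) w" for w
    using gr
  proof (induction ls)
    case (Cons x ls)
    then show ?case
      by (auto simp: algebra_simps weil.scale_left_distrib weil.scale_left_diff_distrib)
  qed simp
  moreover have "split_sum (\<lambda>us x vs. if snd x = 1 then 0 else X us x vs) ls \<in> W_filtration i (even_legs ls)"
  proof (rule split_sum_mem[OF subspace_W_filtration])
    fix us x vs
    assume ls: "ls = us @ x # vs"
    have "X us x vs \<in> W_filtration i (even_legs ls)" if "snd x \<noteq> 1"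
      unfolding X_def
    proof (rule W_filtration_class)
      have x: "snd x = 2"
        using gr that by (auto simp: ls)
      show "weil_diagram (Weil (sprout {fst x} G)
          (old_legs us @ (EndL (fst x), 1) # (EndR (fst x), 1) # old_legs vs) None)"
        using weil_diagram_fork[of G us "fst x" "snd x" vs] D by (simp add: ls)
      show "int (sum_list (map snd (old_legs us @ (EndL (fst x), 1) # (EndR (fst x), 1) # old_legs vs))) = i"
        using i x by (simp add: ls o_def)
      show "even_legs (old_legs us @ (EndL (fst x), 1) # (EndR (fst x), 1) # old_legs vs) < even_legs ls"
        using x by (simp add: ls)
    qed
    then show "(if snd x = 1 then 0 else X us x vs) \<in> W_filtration i (even_legs ls)"
      by (simp add: weil.subspace_0[OF subspace_W_filtration])
  qed
  moreover have "kappa (iota_W ?w) = split_sum (\<lambda>us x vs. if snd x = 1 then ?w else 0) ls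
      + split_sum (\<lambda>us x vs. if snd x = 1 then 0 else X us x vs) ls"
    unfolding kappa_iota_W_class[OF D] split_sum_add[symmetric]
    by (rule split_sum_cong) (simp_all add: X_def)
  ultimately show ?thesis
    by (simp add: i)
qed

lemma kappa_iota_W_triangular:
  assumes "w \<in> W_filtration i (Suc m)"
  shows "kappa (iota_W w) - scaleW (of_int (i - 2 * int m)) w \<in> W_filtration i m"
  using assms
proof (induction rule: W_filtration_induct)
  case zero
  then show ?case
    by (simp add: iota_W.zero kappa.zero weil.subspace_0[OF subspace_W_filtration])
next
  case (step c G ls y)
  let ?w = "weil_class (Weil G ls None)"
  have "kappa (iota_W ?w) - scaleW (of_int (i - 2 * int m)) ?w \<in> W_filtration i m"
  proof (cases "even_legs ls = m")
    case True
    then show ?thesis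
      using kappa_iota_W_triangular_class[OF step(1,2)] by simp
  next
    \<comment> \<open>The eigenvalue of this diagram is another one, but the diagram itself already
      lies in \<open>W_filtration i m\<close>, which absorbs the difference.\<close>
    case False
    then have m: "even_legs ls < m"
      using step(3) by simp
    note add = weil.subspace_add[OF subspace_W_filtration]
      and scale = weil.subspace_scale[OF subspace_W_filtration]
    have "kappa (iota_W ?w) - scaleW (of_int (i - 2 * int (even_legs ls))) ?w \<in> W_filtration i m"
      using kappa_iota_W_triangular_class[OF step(1,2)] W_filtration_mono[of "even_legs ls" m i] m
      by auto
    then have "(kappa (iota_W ?w) - scaleW (of_int (i - 2 * int (even_legs ls))) ?w)
        + scaleW (of_int (i - 2 * int (even_legs ls)) - of_int (i - 2 * int m)) ?w \<in> W_filtration i m"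
      by (intro add scale W_filtration_class step(1,2) m)
    then show ?thesis
      by (simp only: weil.scale_left_diff_distrib) simp
  qed
  then have "scaleW c (kappa (iota_W ?w) - scaleW (of_int (i - 2 * int m)) ?w)
      + (kappa (iota_W y) - scaleW (of_int (i - 2 * int m)) y) \<in> W_filtration i m"
    by (rule weil.subspace_add[OF subspace_W_filtration weil.subspace_scale[OF subspace_W_filtration] step.IH])
  then show ?case
    by (simp add: iota_W.add iota_W.scale kappa.add kappa.scale weil.scale_right_distrib
        weil.scale_right_diff_distrib mult.commute add_diff_add)
qed

text \<open>If \<open>\<iota>\<close> kills \<open>w\<close>, triangularity puts a multiple of
  \<open>w\<close> one step lower. The factor \<open>i - 2 * k\<close> is nonzero by assumption and
  can be divided out, so \<open>w\<close> descends to step 0.\<close>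

lemma iota_W_injective_filtration:
  assumes "w \<in> W_filtration i m" "iota_W w = 0" "\<And>k. k < m \<Longrightarrow> i \<noteq> 2 * int k"
  shows "w = 0"
  using assms
proof (induction m)
  case 0
  then show ?case by (simp add: W_filtration_0)
next
  case (Suc m)
  define c :: rat where "c = of_int (i - 2 * int m)"
  have c: "c \<noteq> 0"
    using Suc.prems(3)[of m] by (simp add: c_def)
  have "- scaleW c w \<in> W_filtration i m"
    using kappa_iota_W_triangular[OF Suc.prems(1)] Suc.prems(2) by (simp add: c_def kappa.zero)
  then have "scaleW (- 1 / c) (- scaleW c w) \<in> W_filtration i m"
    by (rule weil.subspace_scale[OF subspace_W_filtration])
  then have "w \<in> W_filtration i m"
    using c by simp
  then show ?case
    using Suc by simp
qed

lemma iota_W_injective_odd: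
  assumes "w \<in> W_grade i" "iota_W w = 0" "odd i"
  shows "w = 0"
  using assms(1) unfolding W_grade_filtration
  by (rule iota_W_injective_filtration) (use assms(2,3) in auto)


section \<open>A left inverse of \<open>\<Upsilon>\<close>\<close>

text \<open>Forgetting the order of the legs respects Perm because legs of grade 2 commute.\<close>

definition tau_diagram :: "weil \<Rightarrow> ugraph free" where
  "tau_diagram D = (if special D = None \<and> snd ` set (legs D) \<subseteq> {2} then gen (graph D) else 0)"

lemma tau_relations:
  assumes "r \<in> weil_relations"
  shows "lin_ext tau_diagram r \<in> free_span jacobi_relations"
proof -
  consider (iso) D D' f where "r = gen D - gen D'" "weil_diagram D" "weil_diagram D'" "weil_iso f D D'"
    | (loc) Gs ls s where "r = (\<Sum>G\<leftarrow>Gs. gen (Weil G ls s))" "local_relation Gs"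
        "\<And>G. G \<in> set Gs \<Longrightarrow> weil_diagram (Weil G ls s)"
    | (perm) G xs k x l y ys s where
        "r = gen (Weil G (xs @ [(k, x), (l, y)] @ ys) s)
          - smult ((-1) ^ (x * y)) (gen (Weil G (xs @ [(l, y), (k, x)] @ ys) s))"
    using assms unfolding weil_relations_def by blast
  then show ?thesis
  proof cases
    case iso
    have "snd ` set (legs D') = snd ` set (legs D)" "special D' = None \<longleftrightarrow> special D = None"
      using iso(4) by (auto simp: weil_iso_def image_image)
    moreover have "unitrivalent (graph D)" "unitrivalent (graph D')" "graph_iso f (graph D) (graph D')"
      using iso(2-4) by (simp_all add: weil_diagram_def weil_iso_def)
    then have "gen (graph D) - gen (graph D') \<in> jacobi_relations"
      unfolding jacobi_relations_def by blast
    ultimately show ?thesis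
      by (simp add: iso(1) lin_ext.diff tau_diagram_def free.span_base free.span_zero)
  next
    case loc
    have "\<forall>G\<in>set Gs. unitrivalent G"
      using loc(3) by (simp add: weil_diagram_def)
    with loc(2) have "(\<Sum>G\<leftarrow>Gs. gen G) \<in> jacobi_relations"
      unfolding jacobi_relations_def by blast
    moreover have "lin_ext tau_diagram r
        = (if s = None \<and> snd ` set ls \<subseteq> {2} then (\<Sum>G\<leftarrow>Gs. gen G) else 0)"
      unfolding loc(1) by (cases s) (simp_all add: lin_ext_sum_list tau_diagram_def o_def)
    ultimately show ?thesis
      by (simp add: free.span_base free.span_zero)
  next
    case perm
    let ?C = "s = None \<and> snd ` set (xs @ [(k, x), (l, y)] @ ys) \<subseteq> {2}"
    have C: "s = None \<and> snd ` set (xs @ [(l, y), (k, x)] @ ys) \<subseteq> {2} \<longleftrightarrow> ?C"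
      by auto
    have "lin_ext tau_diagram r = (if ?C then gen G else 0) - smult ((-1) ^ (x * y)) (if ?C then gen G else 0)"
      unfolding perm lin_ext.diff lin_ext_smult lin_ext_single tau_diagram_def weil.sel C by simp
    moreover have "x = 2" if ?C
      using that by simp
    ultimately have "lin_ext tau_diagram r = 0"
      by (cases ?C) simp_all
    then show ?thesis
      by (simp add: free.span_zero)
  qed
qed

lift_definition tau :: "weil_space \<Rightarrow> jacobi_space" is "lin_ext tau_diagram"
proof -
  fix p q
  assume "weil_equiv p q"
  then have "lin_ext tau_diagram (p - q) \<in> free_span jacobi_relations"
    by (intro lin_ext_span[OF tau_relations]) (simp_all add: weil_equiv_def)
  then show "jacobi_equiv (lin_ext tau_diagram p) (lin_ext tau_diagram q)"
    by (simp add: jacobi_equiv_def lin_ext.diff)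
qed

lemma linear_tau: "Vector_Spaces.linear scaleW scaleJ tau"
  by unfold_locales
    (transfer; simp add: lin_ext_add lin_ext_smult jacobi_equiv_def free.span_zero)+

interpretation tau: Vector_Spaces.linear scaleW scaleJ tau
  by (rule linear_tau)

lemma tau_class:
  "tau (weil_class (Weil G ls s))
    = (if s = None \<and> snd ` set ls \<subseteq> {2} then jacobi_class G else 0)"
  by (simp add: weil_class_def jacobi_class_def tau.abs_eq tau_diagram_def zero_jacobi_space_def)

lemma graph_iso_sprout_empty: "graph_iso Old G (sprout {} G)"
  by (simp add: graph_iso_def sprout_def bij_betw_def inj_on_def)

text \<open>Only the term with no fork, \<open>S = {}\<close>, is free of grade 1 legs; its graph is
  a relabelled copy of \<open>G\<close>.\<close>

lemma tau_Upsilon_class: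
  assumes G: "unitrivalent G"
  shows "tau (Upsilon (jacobi_class G)) = jacobi_class G"
proof -
  obtain hs where hs: "distinct hs" "set hs = univalent G"
    using exists_ordering[OF G] by blast
  have fin: "finite (univalent G)"
    using G by (simp add: unitrivalent_def univalent_def)
  have "snd ` set (upsilon_legs S hs) \<subseteq> {2} \<longleftrightarrow> set hs \<inter> S = {}" for S
    by (induction hs) auto
  then have "snd ` set (upsilon_legs S hs) \<subseteq> {2} \<longleftrightarrow> S = {}" if "S \<subseteq> univalent G" for S
    unfolding hs(2) using that by (simp add: Int_absorb1)
  then have "tau (Upsilon (jacobi_class G))
      = (\<Sum>S\<in>Pow (univalent G). if S = {} then jacobi_class (sprout {} G) else 0)"
    unfolding Upsilon_class[OF G hs] tau.sum tau.scale tau_class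
    by (intro sum.cong) auto
  also have "\<dots> = jacobi_class (sprout {} G)"
    using fin by (simp add: sum.delta)
  also have "\<dots> = jacobi_class G"
  proof -
    have "gen G - gen (sprout {} G) \<in> jacobi_relations"
      using G unitrivalent_sprout[OF G, of "{}"] graph_iso_sprout_empty
      unfolding jacobi_relations_def by blast
    then have "jacobi_equiv (gen G) (gen (sprout {} G))"
      by (simp add: jacobi_equiv_def free.span_base)
    then have "jacobi_class G = jacobi_class (sprout {} G)"
      by (simp add: jacobi_class_def jacobi_space.abs_eq_iff)
    then show ?thesis ..
  qed
  finally show ?thesis .
qed

lemma B_grade_induct [consumes 1, case_names zero step]:
  assumes "x \<in> B_grade i" "P 0"
    and "\<And>c G y. \<lbrakk>unitrivalent G; 2 * int (card (univalent G)) = i; P y\<rbrakk>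
      \<Longrightarrow> P (scaleJ c (jacobi_class G) + y)"
  shows "P x"
  using assms(1) unfolding B_grade_def
proof (induction rule: jacobi.span_induct_alt)
  case base
  then show ?case using assms(2) .
next
  case (step c x y)
  then show ?case using assms(3) by blast
qed

lemma tau_Upsilon: "x \<in> B_grade i \<Longrightarrow> tau (Upsilon x) = x"
proof (induction rule: B_grade_induct)
  case zero
  then show ?case by (simp add: Upsilon.zero tau.zero)
next
  case (step c G y)
  then show ?case
    by (simp add: Upsilon.add Upsilon.scale tau.add tau.scale tau_Upsilon_class)
qed


section \<open>The isomorphism\<close>

lemma tau_grade: "w \<in> W_grade i \<Longrightarrow> tau w \<in> B_grade i"
  unfolding W_grade_filtration
proof (induction rule: W_filtration_induct)
  case zero
  then show ?case by (simp add: tau.zero B_grade_def jacobi.span_zero)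
next
  case (step c G ls y)
  have "tau (weil_class (Weil G ls None)) \<in> B_grade i"
  proof (cases "snd ` set ls \<subseteq> {2}")
    case True
    have "unitrivalent G" "card (univalent G) = length ls"
      using step(1) distinct_card[of "map fst ls"] by (simp_all add: weil_diagram_def)
    moreover have "sum_list (map snd ls) = 2 * length ls"
      using True by (induction ls) auto
    ultimately have "unitrivalent G \<and> 2 * int (card (univalent G)) = i"
      using step(2) by simp
    then have "jacobi_class G \<in> B_grade i"
      unfolding B_grade_def by (intro jacobi.span_base) blast
    with True show ?thesis
      by (simp add: tau_class)
  next
    case False
    then show ?thesis
      by (simp only: tau_class) (simp add: B_grade_def jacobi.span_zero)
  qed
  then show ?case
    using step.IH by (simp add: tau.add tau.scale B_grade_def jacobi.span_add jacobi.span_scale)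
qed

lemma iota_W_Upsilon: "x \<in> B_grade i \<Longrightarrow> iota_W (Upsilon x) = 0"
proof (induction rule: B_grade_induct)
  case zero
  then show ?case by (simp add: Upsilon.zero iota_W.zero)
next
  case (step c G y)
  then show ?case
    by (simp add: Upsilon.add Upsilon.scale iota_W.add iota_W.scale iota_W_Upsilon_class)
qed

text \<open>The right-hand side of \<open>Cartan\<close> vanishes by
  \<open>invariance\<close>.\<close>

lemma iota_d_anticommute: "w \<in> W_grade i \<Longrightarrow> iota_W (d_W w) + d_W (iota_W w) = 0"
  unfolding W_grade_filtration
proof (induction rule: W_filtration_induct)
  case zero
  then show ?case by (simp add: iota_W.zero d_W.zero)
next
  case (step c G ls y)
  let ?w = "weil_class (Weil G ls None)"
  have "iota_W (d_W ?w) + d_W (iota_W ?w) = 0"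
    using Cartan[of ls G] invariance[OF step(1)] step(1) by (simp add: weil_diagram_def)
  then have "scaleW c (iota_W (d_W ?w) + d_W (iota_W ?w)) + (iota_W (d_W y) + d_W (iota_W y)) = 0"
    using step.IH by simp
  then show ?case
    by (simp add: iota_W.add d_W.add iota_W.scale d_W.scale weil.scale_right_distrib add_ac)
qed

text \<open>Since \<open>d\<close> anticommutes with \<open>\<iota>\<close>, it maps the image of
  \<open>Upsilon\<close> into the kernel of \<open>\<iota>\<close>; but the result has odd grade,
  where \<open>\<iota>\<close> is injective.\<close>

lemma d_W_Upsilon: "x \<in> B_grade i \<Longrightarrow> d_W (Upsilon x) = 0"
proof (induction rule: B_grade_induct)
  case zero
  then show ?case by (simp add: Upsilon.zero d_W.zero)
next
  case (step c G y)
  have "jacobi_class G \<in> B_grade i"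
    unfolding B_grade_def using step(1,2) by (intro jacobi.span_base) blast
  then have grade: "Upsilon (jacobi_class G) \<in> W_grade i"
    by (rule Upsilon_grade)
  have "d_W (Upsilon (jacobi_class G)) = 0"
  proof (rule iota_W_injective_odd)
    show "d_W (Upsilon (jacobi_class G)) \<in> W_grade (i + 1)"
      using grade by (rule d_W_grade)
    show "iota_W (d_W (Upsilon (jacobi_class G))) = 0"
      using iota_d_anticommute[OF grade] by (simp add: iota_W_Upsilon_class[OF step(1)] d_W.zero)
    show "odd (i + 1)"
      using step(2) by presburger
  qed
  then show ?case
    using step.IH by (simp add: Upsilon.add Upsilon.scale d_W.add d_W.scale)
qed

lemma even_legs_upsilon_legs:
  "distinct hs \<Longrightarrow> S \<subseteq> set hs \<Longrightarrow> even_legs (upsilon_legs S hs) = length hs - card S"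
proof -
  assume hs: "distinct hs" "S \<subseteq> set hs"
  have "even_legs (upsilon_legs S hs) = length (filter (\<lambda>h. h \<notin> S) hs)"
    by (induction hs) auto
  also have "\<dots> = card (set hs - S)"
    using hs(1) by (simp add: set_diff_eq flip: distinct_card)
  also have "\<dots> = length hs - card S"
    using hs by (simp add: card_Diff_subset finite_subset distinct_card)
  finally show ?thesis .
qed

text \<open>If all legs have grade 2, \<open>Upsilon\<close> restores the diagram that
  \<open>tau\<close> has stripped, up to terms with forks. Any other diagram is killed by
  \<open>tau\<close> and has fewer than \<open>m\<close> grade 2 legs itself.\<close>

lemma Upsilon_tau_class:
  assumes D: "weil_diagram (Weil G ls None)" and m: "sum_list (map snd ls) = 2 * m"
  shows "weil_class (Weil G ls None) - Upsilon (tau (weil_class (Weil G ls None)))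
    \<in> W_filtration (2 * int m) m"
proof (cases "snd ` set ls \<subseteq> {2}")
  case True
  define hs where "hs = map fst ls"
  have G: "unitrivalent G" and hs: "distinct hs" "set hs = univalent G"
    using D by (simp_all add: weil_diagram_def hs_def)
  have fin: "finite (univalent G)"
    using G by (simp add: unitrivalent_def univalent_def)
  have "sum_list (map snd ls) = 2 * length ls"
    using True by (induction ls) auto
  then have len: "length hs = m"
    using m by (simp add: hs_def)
  define w where "w S = weil_class (Weil (sprout S G) (upsilon_legs S hs) None)" for S
  have valid: "weil_diagram (Weil (sprout S G) (upsilon_legs S hs) None)" if "S \<subseteq> univalent G" for S
    using that by (rule weil_diagram_upsilon[OF G hs])
  have "upsilon_legs {} hs = map (apfst Old) ls"
    unfolding hs_def using True by (induction ls) auto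
  then have "weil_class (Weil G ls None) = w {}"
    unfolding w_def using D valid[of "{}"] graph_iso_sprout_empty
    by (intro weil_class_iso[where f = Old]) (simp_all add: weil_iso_def)
  moreover have "tau (weil_class (Weil G ls None)) = jacobi_class G"
    using True by (simp add: tau_class)
  moreover have "Upsilon (jacobi_class G) = w {} + (\<Sum>S\<in>Pow (univalent G) - {{}}. scaleW ((- 1 / 2) ^ card S) (w S))"
    unfolding Upsilon_class[OF G hs] w_def[symmetric] using fin
    by (subst sum.remove[of _ "{}"]) auto
  moreover have "(\<Sum>S\<in>Pow (univalent G) - {{}}. scaleW ((- 1 / 2) ^ card S) (w S)) \<in> W_filtration (2 * int m) m"
  proof (intro weil.subspace_sum[OF subspace_W_filtration] weil.subspace_scale[OF subspace_W_filtration])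
    fix S
    assume S: "S \<in> Pow (univalent G) - {{}}"
    then have "card S > 0"
      using fin finite_subset by (auto simp: card_gt_0_iff)
    moreover have "card S \<le> length hs"
      using S fin hs card_mono[of "univalent G" S] distinct_card[OF hs(1)] by simp
    ultimately have "even_legs (upsilon_legs S hs) < m"
      using even_legs_upsilon_legs[OF hs(1), of S] S hs(2) len by simp
    then show "w S \<in> W_filtration (2 * int m) m"
      unfolding w_def using S valid[of S] len
      by (intro W_filtration_class) (simp_all add: grade_upsilon_legs)
  qed
  ultimately show ?thesis
    by (simp add: weil.subspace_neg[OF subspace_W_filtration])
next
  case False
  have gr: "snd ` set ls \<subseteq> {1, 2}"
    using D by (simp add: weil_diagram_def)
  obtain x where "x \<in> set ls" "snd x \<noteq> 2"
    using False by auto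
  then have "even_legs ls < length ls"
    unfolding even_legs_def by (rule length_filter_less)
  then have "even_legs ls < m"
    using grade_even_legs[OF gr] m by simp
  moreover have "tau (weil_class (Weil G ls None)) = 0"
    using False by (simp only: tau_class) simp
  ultimately show ?thesis
    using D m by (simp add: Upsilon.zero W_filtration_class)
qed

lemma Upsilon_tau:
  assumes "w \<in> W_grade (2 * int m)"
  shows "w - Upsilon (tau w) \<in> W_filtration (2 * int m) m"
  using assms unfolding W_grade_filtration
proof (induction rule: W_filtration_induct)
  case zero
  then show ?case
    by (simp add: tau.zero Upsilon.zero weil.subspace_0[OF subspace_W_filtration])
next
  case (step c G ls y)
  let ?w = "weil_class (Weil G ls None)"
  have "?w - Upsilon (tau ?w) \<in> W_filtration (2 * int m) m"
    by (rule Upsilon_tau_class[OF step(1)]) (use step(2) in linarith)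
  then have "scaleW c (?w - Upsilon (tau ?w)) + (y - Upsilon (tau y)) \<in> W_filtration (2 * int m) m"
    by (rule weil.subspace_add[OF subspace_W_filtration weil.subspace_scale[OF subspace_W_filtration] step.IH])
  then show ?case
    by (simp add: tau.add tau.scale Upsilon.add Upsilon.scale weil.scale_right_diff_distrib add_diff_add)
qed

text \<open>The preimage of \<open>w\<close> is \<open>tau w\<close>: for
  \<open>i = 2 * int m\<close>, the difference \<open>w - Upsilon (tau w)\<close> is killed by
  \<open>\<iota>\<close> and lies in step \<open>m\<close>, where only the nonzero eigenvalues with
  \<open>k < m\<close> occur.\<close>

lemma W_basic_eq: "W_basic i = Upsilon ` B_grade i"
proof
  show "Upsilon ` B_grade i \<subseteq> W_basic i"
    by (auto simp: W_basic_def Upsilon_grade iota_W_Upsilon)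
  show "W_basic i \<subseteq> Upsilon ` B_grade i"
  proof
    fix w
    assume "w \<in> W_basic i"
    then have w: "w \<in> W_grade i" "iota_W w = 0"
      by (simp_all add: W_basic_def)
    have "w - Upsilon (tau w) = 0"
    proof (cases "even i \<and> i \<ge> 0")
      case True
      then have i: "i = 2 * int (nat (i div 2))"
        by auto
      define m where "m = nat (i div 2)"
      note i = i[folded m_def]
      show ?thesis
      proof (rule iota_W_injective_filtration)
        show "w - Upsilon (tau w) \<in> W_filtration i m"
          using Upsilon_tau[of w m] w(1) by (simp flip: i)
        show "iota_W (w - Upsilon (tau w)) = 0"
          using w iota_W_Upsilon[OF tau_grade[OF w(1)]] by (simp add: iota_W.diff)
      qed (simp add: i)
    next
      \<comment> \<open>For odd or negative \<open>i\<close> no eigenvalue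
        \<open>i - 2 * int k\<close> vanishes, so \<open>\<iota>\<close> is injective on the whole
        grade.\<close>
      case False
      have "w = 0"
        using w(1) unfolding W_grade_filtration
        by (rule iota_W_injective_filtration) (use w(2) False in auto)
      then show ?thesis
        by (simp add: tau.zero Upsilon.zero)
    qed
    then show "w \<in> Upsilon ` B_grade i"
      using tau_grade[OF w(1)] by (metis eq_iff_diff_eq_0 imageI)
  qed
qed

lemma basic_cocycles_eq: "basic_cocycles i = Upsilon ` B_grade i"
  unfolding basic_cocycles_def W_basic_eq using d_W_Upsilon by auto

text \<open>The basic elements of degree \<open>i - 1\<close> also form the image of
  \<open>Upsilon\<close>, on which \<open>d\<close> vanishes.\<close>

lemma basic_coboundaries_eq: "basic_coboundaries i = {0}"
proof -
  have "0 \<in> B_grade (i - 1)"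
    by (simp add: B_grade_def jacobi.span_zero)
  then show ?thesis
    unfolding basic_coboundaries_def W_basic_eq using d_W_Upsilon[of _ "i - 1"] by (auto simp: image_iff)
qed

lemma cohomologous_eq: "cohomologous i = Id_on (basic_cocycles i)"
  by (auto simp: cohomologous_def basic_coboundaries_eq)

theorem theorem4p2p3:
  fixes i :: int
  shows "bij_betw (H_Upsilon i) (B_grade i) (H_basic i) \<and>
    (\<forall>x\<in>B_grade i. \<forall>y\<in>B_grade i.
       H_Upsilon i (x + y) = H_add i (H_Upsilon i x) (H_Upsilon i y)) \<and>
    (\<forall>c. \<forall>x\<in>B_grade i. H_Upsilon i (scaleJ c x) = H_scale i c (H_Upsilon i x))"
proof (intro conjI ballI allI)
  have cocycle: "Upsilon x \<in> basic_cocycles i" if "x \<in> B_grade i" for x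
    using that by (simp add: basic_cocycles_eq)
  \<comment> \<open>Without nonzero coboundaries, cohomologous cocycles are equal and every class is
    a singleton.\<close>
  have single: "H_Upsilon i x = {Upsilon x}" if "x \<in> B_grade i" for x
    using cocycle[OF that] by (auto simp: H_Upsilon_def H_class_def cohomologous_eq)
  have "inj_on (H_Upsilon i) (B_grade i)"
    by (rule inj_onI) (metis single singleton_inject tau_Upsilon)
  moreover have "H_Upsilon i ` B_grade i = H_basic i"
    by (simp add: H_basic_def quotient_def basic_cocycles_eq H_Upsilon_def H_class_def UNION_singleton_eq_range image_image)
  ultimately show "bij_betw (H_Upsilon i) (B_grade i) (H_basic i)"
    by (simp add: bij_betw_def)
  show "H_Upsilon i (x + y) = H_add i (H_Upsilon i x) (H_Upsilon i y)"
    if "x \<in> B_grade i" "y \<in> B_grade i" for x y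
    using H_add_class[OF cocycle[OF that(1)] cocycle[OF that(2)]]
    by (simp add: H_Upsilon_def Upsilon.add)
  show "H_Upsilon i (scaleJ c x) = H_scale i c (H_Upsilon i x)" if "x \<in> B_grade i" for c x
    using H_scale_class[OF cocycle[OF that]] by (simp add: H_Upsilon_def Upsilon.scale)
qed

end
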